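(* The family of generalized Petersen graphs can be recognized in linear time: there exists a deterministic algorithm which, given as input a finite simple graph $H$ (represented by adjacency lists), decides in time $O(|V(H)|+|E(H)|)$ whether $H$ is isomorphic to some generalized Petersen graph $G(n,k)$ with integers $n\ge 3$ and $1\le k<n/2$. (In particular, for a cubic input graph on $2n$ vertices the running time is $O(n)$.)
   Context: For integers $n\ge 3$ and $1\le k<n/2$, the generalized Petersen graph $G(n,k)$ is the cubic graph with vertex set $\{u_0,\dots,u_{n-1},w_0,\dots,w_{n-1}\}$ and edge set $\{u_iu_{i+1}\}\cup\{u_iw_i\}\cup\{w_iw_{i+k}\}$ for $i=0,1,\dots,n-1$, all subscripts taken modulo $n$. The input graph is unlabeled: neither $n$, $k$ nor the correspondence of vertices with the $u_i,w_i$ is given. Running time is measured in the standard unit-cost RAM model with words of logarithmic size. *)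

theory Defs
  imports Main "HOL-Library.Discrete_Functions"
begin

definition simple_graph :: "'a set \<Rightarrow> 'a set set \<Rightarrow> bool" where
  "simple_graph V E \<longleftrightarrow> finite V \<and> (\<forall>e\<in>E. e \<subseteq> V \<and> card e = 2)"

definition graph_isomorphic ::
    "'a set \<Rightarrow> 'a set set \<Rightarrow> 'b set \<Rightarrow> 'b set set \<Rightarrow> bool" where
  "graph_isomorphic V E V' E' \<longleftrightarrow>
     (\<exists>f. bij_betw f V V' \<and> (\<forall>x\<in>V. \<forall>y\<in>V. {x, y} \<in> E \<longleftrightarrow> {f x, f y} \<in> E'))"

definition cubic :: "'a set \<Rightarrow> 'a set set \<Rightarrow> bool" where
  "cubic V E \<longleftrightarrow> (\<forall>v\<in>V. card {e \<in> E. v \<in> e} = 3)"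

datatype gp_vertex = U nat | W nat

definition gp_verts :: "nat \<Rightarrow> gp_vertex set" where
  "gp_verts n = U ` {..<n} \<union> W ` {..<n}"

definition gp_edges :: "nat \<Rightarrow> nat \<Rightarrow> gp_vertex set set" where
  "gp_edges n k =
     {{U i, U ((i + 1) mod n)} | i. i < n} \<union>
     {{U i, W i} | i. i < n} \<union>
     {{W i, W ((i + k) mod n)} | i. i < n}"

definition is_generalized_Petersen :: "'a set \<Rightarrow> 'a set set \<Rightarrow> bool" where
  "is_generalized_Petersen V E \<longleftrightarrow>
     (\<exists>n k. 3 \<le> n \<and> 1 \<le> k \<and> 2 * k < n \<and>
        graph_isomorphic V E (gp_verts n) (gp_edges n k))"

text \<open>
  The vertices are numbered in an arbitrary way (\<open>vs\<close>), and the neighbours of each vertex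
  are listed, by number, in an arbitrary order.
\<close>

definition adjacency_lists :: "'a set \<Rightarrow> 'a set set \<Rightarrow> nat list list \<Rightarrow> bool" where
  "adjacency_lists V E L \<longleftrightarrow>
     (\<exists>vs. distinct vs \<and> set vs = V \<and> length vs = length L \<and>
        (\<forall>i<length L. distinct (L ! i) \<and>
           set (L ! i) = {j. j < length L \<and> {vs ! i, vs ! j} \<in> E}))"

text \<open>
  As a sequence of words: the number of vertices, followed for each vertex by its degree and
  its list of neighbours.
\<close>

definition encode :: "nat list list \<Rightarrow> nat list" where
  "encode L = length L # concat (map (\<lambda>l. length l # l) L)"

text \<open>
  A unit-cost RAM. A program addresses finitely many registers directly, and the memory
  through addresses held in registers. Subtraction is truncated at \<open>0\<close>, division is integer division, and every
  instruction takes one time unit.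
\<close>

datatype binop = Add | Sub | Mul | Div

datatype instr =
    Const nat nat
  | Op binop nat nat nat
  | Load nat nat
  | Store nat nat
  | Jump nat
  | JumpEq nat nat nat
  | JumpLess nat nat nat

record config =
  pc :: nat
  regs :: "nat \<Rightarrow> nat"
  mem :: "nat \<Rightarrow> nat"

fun apply_binop :: "binop \<Rightarrow> nat \<Rightarrow> nat \<Rightarrow> nat" where
  "apply_binop Add a b = a + b"
| "apply_binop Sub a b = a - b"
| "apply_binop Mul a b = a * b"
| "apply_binop Div a b = a div b"

definition set_reg :: "nat \<Rightarrow> nat \<Rightarrow> config \<Rightarrow> config" where
  "set_reg r a s = s\<lparr>pc := pc s + 1, regs := (regs s)(r := a)\<rparr>"

fun exec :: "instr \<Rightarrow> config \<Rightarrow> config" where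
  "exec (Const r a) s = set_reg r a s"
| "exec (Op f r i j) s = set_reg r (apply_binop f (regs s i) (regs s j)) s"
| "exec (Load r i) s = set_reg r (mem s (regs s i)) s"
| "exec (Store r i) s = s\<lparr>pc := pc s + 1, mem := (mem s)(regs s r := regs s i)\<rparr>"
| "exec (Jump l) s = s\<lparr>pc := l\<rparr>"
| "exec (JumpEq i j l) s = s\<lparr>pc := if regs s i = regs s j then l else pc s + 1\<rparr>"
| "exec (JumpLess i j l) s = s\<lparr>pc := if regs s i < regs s j then l else pc s + 1\<rparr>"

text \<open>The machine halts by moving the program counter out of the program; the answer is then in
  register \<open>0\<close>.\<close>

definition halted :: "instr list \<Rightarrow> config \<Rightarrow> bool" where
  "halted P s \<longleftrightarrow> length P \<le> pc s"

definition step :: "instr list \<Rightarrow> config \<Rightarrow> config" where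
  "step P s = (if halted P s then s else exec (P ! pc s) s)"

definition init :: "nat list \<Rightarrow> config" where
  "init xs = \<lparr>pc = 0, regs = (\<lambda>_. 0), mem = (\<lambda>a. if a < length xs then xs ! a else 0)\<rparr>"

definition run :: "instr list \<Rightarrow> nat list \<Rightarrow> nat \<Rightarrow> config" where
  "run P xs t = (step P ^^ t) (init xs)"

text \<open>
  Words have \<open>c \<cdot> (\<lfloor>log\<^sub>2 N\<rfloor> + 1)\<close> bits, where \<open>N\<close> is the input length and \<open>c\<close> a constant
  belonging to the algorithm. No word may overflow during the computation; since addresses are
  register contents, this also bounds the accessible memory.
\<close>

definition word_bits :: "nat \<Rightarrow> nat list \<Rightarrow> nat" where
  "word_bits c xs = c * (floor_log (length xs) + 1)"

definition fits_words :: "nat \<Rightarrow> config \<Rightarrow> bool" where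
  "fits_words b s \<longleftrightarrow> (\<forall>r. regs s r < 2 ^ b) \<and> (\<forall>a. mem s a < 2 ^ b)"

definition decides_within ::
    "instr list \<Rightarrow> nat \<Rightarrow> nat list \<Rightarrow> nat \<Rightarrow> bool \<Rightarrow> bool" where
  "decides_within P c xs T ans \<longleftrightarrow>
     (\<exists>t\<le>T. halted P (run P xs t) \<and>
        (\<forall>t'\<le>t. fits_words (word_bits c xs) (run P xs t')) \<and>
        regs (run P xs t) 0 = (if ans then 1 else 0))"

text \<open>
  The additive \<open>1\<close> in the bound matters only for the graph without vertices, on which no
  program that reads its input halts in \<open>0\<close> steps.
\<close>

definition recognizes_gp_in_linear_time :: "instr list \<Rightarrow> nat \<Rightarrow> bool" where
  "recognizes_gp_in_linear_time P c \<longleftrightarrow>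
     (\<exists>C. \<forall>(V :: nat set) E L. simple_graph V E \<and> adjacency_lists V E L \<longrightarrow>
        decides_within P c (encode L) (C * (card V + card E + 1))
          (is_generalized_Petersen V E))"

end

theory Submission
  imports Defs
begin

text \<open>
  Write \<open>u\<^sub>x\<close>, \<open>w\<^sub>x\<close> for the vertices of \<open>G(n, k)\<close>, with indices in the integers modulo \<open>n\<close>. Suppose
  that \<open>a = u\<^sub>x\<close>, \<open>b = w\<^sub>x\<close> and \<open>c = u\<^bsub>x+1\<^esub>\<close> are already known in an unlabelled copy of the graph.
  The two other neighbours of \<open>c\<close> are \<open>w\<^bsub>x+1\<^esub>\<close> and \<open>u\<^bsub>x+2\<^esub>\<close>; whoever can tell these two apart can
  walk once around the outer rim and label the whole graph in \<open>n\<close> steps of constant cost.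

  The two are told apart by a test of bounded radius: for \<open>k \<noteq> 1\<close>, both neighbours
  \<open>w\<^bsub>x+k\<^esub>\<close>, \<open>w\<^bsub>x-k\<^esub>\<close> of \<open>b\<close> other than \<open>a\<close> can be reached from \<open>w\<^bsub>x+1\<^esub>\<close> by a path of length four that
  avoids \<open>c\<close> as its second vertex (\<open>spoke_test_spoke\<close>); such a path completes the eight-cycle through
  \<open>u\<^sub>x u\<^bsub>x+1\<^esub>\<close>. From \<open>u\<^bsub>x+2\<^esub>\<close> a path of this kind to \<open>w\<^bsub>x+k\<^esub>\<close> or to \<open>w\<^bsub>x-k\<^esub>\<close> costs a linear relation
  \<open>p + q k \<equiv> 0\<close> modulo \<open>n\<close> with small \<open>p\<close>, \<open>q\<close> (\<open>four_path_relation\<close>). Two independent relations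
  make \<open>n\<close> divide their determinant, which is at most \<open>22\<close>, and the few pairs of dependent ones
  contradict \<open>1 < k < n / 2\<close> when \<open>n > 22\<close> (\<open>spoke_test_rim\<close>). Two cases remain. In the prism, \<open>k = 1\<close>, the
  vertex \<open>w\<^bsub>x+1\<^esub>\<close> is adjacent to \<open>b\<close> and \<open>u\<^bsub>x+2\<^esub>\<close> is not. For \<open>n \<le> 22\<close> the at most \<open>22\<close> choices along the
  walk are prescribed by a table, and all the finitely many tables are tried. So a constant number of
  rules suffices, one of which is right for each generalized Petersen graph (\<open>rule_exists\<close>).

  The algorithm first checks that the graph is cubic and has an even number \<open>2 n \<ge> 6\<close> of vertices. Then it
  tries constantly many guesses, each consisting of a start \<open>u\<^sub>0\<close> among vertex \<open>0\<close> and its neighbours,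
  of the positions of \<open>w\<^sub>0\<close> and \<open>u\<^sub>1\<close> in the list of \<open>u\<^sub>0\<close>, of a rule, and of the position of \<open>w\<^sub>k\<close> in the list
  of \<open>w\<^sub>0\<close>. After each walk the labelling found is verified completely, in linear time. The verification
  alone makes a positive answer correct (\<open>check_sound\<close>), whatever the rules may do; a right guess makes
  the walk produce a correct labelling (\<open>ok_walk\<close>, \<open>guess_exists\<close>), so that no positive instance is missed.

  On the machine side, the program is written in a small structured language and compiled
  (\<open>compile_correct\<close>). One number \<open>csize\<close>, read off from the source text, bounds everything that is
  independent of the input: the variables that occur, the number of machine instructions per loop iteration,
  and the exponent in the bound \<open>M ^ csize\<close> on intermediate results if variables and memory cells
  stay below \<open>M\<close>. Since no loop contains another one and each runs at most \<open>|V|\<close> times, linear time and the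
  word bound follow for the whole program at once (\<open>compiled_program_decides\<close>).
\<close>

section \<open>A structured language\<close>

datatype exp = Lit nat | Var nat | Bin binop exp exp | Cell exp

datatype cmd =
    Skip
  | Assign nat exp
  | Write exp exp
  | Seq cmd cmd
  | Cond exp cmd cmd
  | While exp cmd

type_synonym state = "(nat \<Rightarrow> nat) \<times> (nat \<Rightarrow> nat)"

primrec val :: "exp \<Rightarrow> (nat \<Rightarrow> nat) \<Rightarrow> (nat \<Rightarrow> nat) \<Rightarrow> nat" where
  "val (Lit k) R m = k"
| "val (Var x) R m = R x"
| "val (Bin f d e) R m = apply_binop f (val d R m) (val e R m)"
| "val (Cell e) R m = m (val e R m)"

primrec elen :: "exp \<Rightarrow> nat" where
  "elen (Lit k) = 1"
| "elen (Var x) = 2"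
| "elen (Bin f d e) = elen d + elen e + 1"
| "elen (Cell e) = elen e + 1"

text \<open>Big-step semantics, with the exact number of machine steps that the compiled code will take. Every
value stored in a variable or in memory must be at most \<open>M\<close>; intermediate results need not be.\<close>

inductive big :: "nat \<Rightarrow> cmd \<Rightarrow> state \<Rightarrow> nat \<Rightarrow> state \<Rightarrow> bool" for M where
  Skip: "big M Skip s 0 s"
| Assign: "val e R m \<le> M \<Longrightarrow> big M (Assign x e) (R, m) (elen e + 2) (R(x := val e R m), m)"
| Write: "val e R m \<le> M \<Longrightarrow>
    big M (Write d e) (R, m) (elen d + elen e + 1) (R, m(val d R m := val e R m))"
| Seq: "big M c s t s' \<Longrightarrow> big M d s' t' s'' \<Longrightarrow> big M (Seq c d) s (t + t') s''"
| CondT: "val e R m \<noteq> 0 \<Longrightarrow> big M c (R, m) t s' \<Longrightarrow> big M (Cond e c d) (R, m) (elen e + 2 + t + 1) s'"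
| CondF: "val e R m = 0 \<Longrightarrow> big M d (R, m) t s' \<Longrightarrow> big M (Cond e c d) (R, m) (elen e + 2 + t) s'"
| WhileT: "val e R m \<noteq> 0 \<Longrightarrow> big M c (R, m) t s' \<Longrightarrow> big M (While e c) s' t' s'' \<Longrightarrow>
    big M (While e c) (R, m) (elen e + 2 + t + 1 + t') s''"
| WhileF: "val e R m = 0 \<Longrightarrow> big M (While e c) (R, m) (elen e + 2) (R, m)"

text \<open>The size also counts literals and variable numbers. So it dominates the length of the code, the
variables that occur, and, through \<open>k \<le> 2 ^ k\<close>, the literals as well.\<close>

primrec esize :: "exp \<Rightarrow> nat" where
  "esize (Lit k) = k + 2"
| "esize (Var x) = x + 2"
| "esize (Bin f d e) = esize d + esize e + 1"
| "esize (Cell e) = esize e + 1"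

primrec csize :: "cmd \<Rightarrow> nat" where
  "csize Skip = 1"
| "csize (Assign x e) = x + esize e + 3"
| "csize (Write d e) = esize d + esize e + 3"
| "csize (Seq c d) = csize c + csize d"
| "csize (Cond e c d) = esize e + csize c + csize d + 4"
| "csize (While e c) = esize e + csize c + 4"

lemma elen_le_esize: "elen e \<le> esize e"
  by (induction e) auto

lemma esize_ge2: "2 \<le> esize e"
  by (induction e) auto

lemma add_le_mult: "a + b \<le> a * b" if "2 \<le> a" "2 \<le> b" for a b :: nat
proof -
  have "a + b \<le> 2 * max a b" by simp
  also have "\<dots> \<le> min a b * max a b" using that by (intro mult_le_mono1) simp
  also have "\<dots> = a * b" by (simp add: min_def max_def)
  finally show ?thesis .
qed

text \<open>Sums are the reason for \<open>2 \<le> M\<close>: on numbers from \<open>2\<close> on, addition is bounded by multiplication, and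
sizes add up in the exponent.\<close>

lemma val_le:
  assumes "\<And>r. r < esize e \<Longrightarrow> R r \<le> M" and "\<And>a. m a \<le> M" and "2 \<le> M"
  shows "val e R m \<le> M ^ esize e"
  using assms(1)
proof (induction e)
  case (Lit k)
  have "k \<le> 2 ^ (k + 2)"
    by (metis le_add1 less_exp less_imp_le_nat order_less_le_trans power_increasing one_le_numeral)
  also have "\<dots> \<le> M ^ (k + 2)"
    using assms(3) by (rule power_mono) simp
  finally show ?case by simp
next
  case (Var x)
  have "R x \<le> M ^ 1" using Var by simp
  also have "\<dots> \<le> M ^ (x + 2)" using assms(3) by (intro power_increasing) auto
  finally show ?case by simp
next
  case (Bin f d e)
  have d: "val d R m \<le> M ^ esize d" and e: "val e R m \<le> M ^ esize e"
    using Bin by auto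
  have ge: "2 \<le> M ^ esize g" for g
  proof -
    have "2 \<le> M ^ 1" using assms(3) by simp
    also have "\<dots> \<le> M ^ esize g" using assms(3) esize_ge2[of g] by (intro power_increasing) auto
    finally show ?thesis .
  qed
  have le: "M ^ esize d * M ^ esize e \<le> M ^ esize (Bin f d e)"
    using assms(3) by (simp add: power_add)
  have d': "M ^ esize d \<le> M ^ esize d * M ^ esize e"
    using assms(3) by simp
  have "val (Bin f d e) R m \<le> M ^ esize d * M ^ esize e"
  proof (cases f)
    case Add
    then show ?thesis using d e add_le_mult[OF ge[of d] ge[of e]] by simp
  next
    case Sub
    have "val d R m - val e R m \<le> val d R m" by (rule diff_le_self)
    also note d
    also note d'
    finally show ?thesis using Sub by simp
  next
    case Mul
    then show ?thesis using d e by (simp add: mult_le_mono)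
  next
    case Div
    have "val d R m div val e R m \<le> val d R m" by (rule div_le_dividend)
    also note d
    also note d'
    finally show ?thesis using Div by simp
  qed
  then show ?case using le by (rule order_trans)
next
  case (Cell e)
  have "m (val e R m) \<le> M ^ 1" using assms(2) by simp
  also have "\<dots> \<le> M ^ esize (Cell e)" using assms(3) by (intro power_increasing) auto
  finally show ?case by simp
qed

lemma val_cong:
  "(\<And>r. r < esize e \<Longrightarrow> R r = R' r) \<Longrightarrow> val e R m = val e R' m"
  by (induction e) auto

section \<open>Compilation to the machine\<close>

text \<open>The result is delivered in register \<open>t\<close>, and the registers from \<open>t\<close> on serve as an evaluation stack.\<close>

primrec compile_exp :: "nat \<Rightarrow> exp \<Rightarrow> instr list" where
  "compile_exp t (Lit k) = [Const t k]"
| "compile_exp t (Var x) = [Const t 0, Op Add t t x]"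
| "compile_exp t (Bin f d e) =
    compile_exp t d @ compile_exp (Suc t) e @ [Op f t t (Suc t)]"
| "compile_exp t (Cell e) = compile_exp t e @ [Load t t]"

primrec clen :: "cmd \<Rightarrow> nat" where
  "clen Skip = 0"
| "clen (Assign x e) = elen e + 2"
| "clen (Write d e) = elen d + elen e + 1"
| "clen (Seq c d) = clen c + clen d"
| "clen (Cond e c d) = elen e + 2 + clen c + 1 + clen d"
| "clen (While e c) = elen e + 2 + clen c + 1"

text \<open>Registers below \<open>v\<close> hold the variables, registers from \<open>v\<close> on the evaluation stack; \<open>l\<close> is the address of the
first instruction, needed because jumps are absolute. There is no instruction that moves a register, so
a number is moved by adding \<open>0\<close> to it.\<close>

primrec compile :: "nat \<Rightarrow> nat \<Rightarrow> cmd \<Rightarrow> instr list" where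
  "compile v l Skip = []"
| "compile v l (Assign x e) = compile_exp v e @ [Const (Suc v) 0, Op Add x v (Suc v)]"
| "compile v l (Write d e) = compile_exp v d @ compile_exp (Suc v) e @ [Store v (Suc v)]"
| "compile v l (Seq c d) = compile v l c @ compile v (l + clen c) d"
| "compile v l (Cond e c d) =
    compile_exp v e @ [Const (Suc v) 0, JumpEq v (Suc v) (l + elen e + 2 + clen c + 1)] @
    compile v (l + elen e + 2) c @ [Jump (l + clen (Cond e c d))] @
    compile v (l + elen e + 2 + clen c + 1) d"
| "compile v l (While e c) =
    compile_exp v e @ [Const (Suc v) 0, JumpEq v (Suc v) (l + clen (While e c))] @
    compile v (l + elen e + 2) c @ [Jump l]"

lemma length_compile_exp [simp]: "length (compile_exp t e) = elen e"
  by (induction e arbitrary: t) auto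

lemma length_compile [simp]: "length (compile v l c) = clen c"
  by (induction c arbitrary: l) auto

definition code_at :: "instr list \<Rightarrow> nat \<Rightarrow> instr list \<Rightarrow> bool" where
  "code_at P l xs \<longleftrightarrow> (\<forall>i<length xs. l + i < length P \<and> P ! (l + i) = xs ! i)"

lemma code_at_Nil [simp]: "code_at P l []"
  by (simp add: code_at_def)

lemma code_at_append [simp]:
  "code_at P l (xs @ ys) \<longleftrightarrow> code_at P l xs \<and> code_at P (l + length xs) ys"
proof (intro iffI conjI)
  assume *: "code_at P l (xs @ ys)"
  show "code_at P l xs"
    unfolding code_at_def
  proof (intro allI impI)
    fix i assume "i < length xs"
    then show "l + i < length P \<and> P ! (l + i) = xs ! i"
      using *[unfolded code_at_def, rule_format, of i] by (simp add: nth_append)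
  qed
  show "code_at P (l + length xs) ys"
    unfolding code_at_def
  proof (intro allI impI)
    fix i assume "i < length ys"
    then show "l + length xs + i < length P \<and> P ! (l + length xs + i) = ys ! i"
      using *[unfolded code_at_def, rule_format, of "length xs + i"] by (simp add: add.assoc)
  qed
next
  assume *: "code_at P l xs \<and> code_at P (l + length xs) ys"
  show "code_at P l (xs @ ys)"
    unfolding code_at_def
  proof (intro allI impI)
    fix i assume i: "i < length (xs @ ys)"
    show "l + i < length P \<and> P ! (l + i) = (xs @ ys) ! i"
    proof (cases "i < length xs")
      case True
      then show ?thesis using * by (simp add: code_at_def nth_append)
    next
      case False
      define j where "j = i - length xs"
      have "i = length xs + j" "j < length ys" using False i by (auto simp: j_def)
      then show ?thesis using * by (auto simp: code_at_def nth_append add.assoc)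
    qed
  qed
qed

lemma code_at_Cons [simp]:
  "code_at P l (x # xs) \<longleftrightarrow> l < length P \<and> P ! l = x \<and> code_at P (Suc l) xs"
proof -
  have "code_at P l (x # xs) \<longleftrightarrow> code_at P l [x] \<and> code_at P (l + 1) xs"
    using code_at_append[of P l "[x]" xs] by simp
  then show ?thesis by (simp add: code_at_def)
qed

text \<open>Words must not overflow at any time, hence the condition on all intermediate configurations.\<close>

definition reach :: "instr list \<Rightarrow> nat \<Rightarrow> config \<Rightarrow> nat \<Rightarrow> config \<Rightarrow> bool" where
  "reach P b s t s' \<longleftrightarrow>
    (step P ^^ t) s = s' \<and> (\<forall>t'\<le>t. fits_words b ((step P ^^ t') s))"

lemma reach_refl: "fits_words b s \<Longrightarrow> reach P b s 0 s"
  by (simp add: reach_def)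

lemma reach_fits: "reach P b s t s' \<Longrightarrow> fits_words b s'"
  by (auto simp: reach_def)

lemma reach_trans:
  assumes "reach P b s t s'" "reach P b s' t' s''"
  shows "reach P b s (t + t') s''"
  unfolding reach_def
proof (intro conjI allI impI)
  have *: "(step P ^^ (t + i)) s = (step P ^^ i) s'" for i
    using assms(1) by (simp add: reach_def add.commute[of t] funpow_add)
  show "(step P ^^ (t + t')) s = s''" using * assms(2) by (simp add: reach_def)
  fix i assume "i \<le> t + t'"
  show "fits_words b ((step P ^^ i) s)"
  proof (cases "i \<le> t")
    case True
    then show ?thesis using assms(1) by (simp add: reach_def)
  next
    case False
    then obtain j where "i = t + j" "j \<le> t'"
      using \<open>i \<le> t + t'\<close> by (metis add_le_cancel_left le_Suc_ex nat_le_linear)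
    then show ?thesis using * assms(2) by (simp add: reach_def)
  qed
qed

lemma reach_one:
  assumes "fits_words b s" "pc s < length P" "fits_words b (exec (P ! pc s) s)"
  shows "reach P b s 1 (exec (P ! pc s) s)"
  using assms by (auto simp: reach_def step_def halted_def le_Suc_eq)

lemma reach_snoc:
  assumes "reach P b s t s'" "pc s' < length P" "s'' = exec (P ! pc s') s'" "fits_words b s''"
  shows "reach P b s (Suc t) s''"
  using reach_trans[OF assms(1) reach_one[of b s' P]] assms reach_fits[OF assms(1)] by simp

lemma compile_exp_correct:
  assumes "code_at P (pc s) (compile_exp t e)" "esize e \<le> v" "v \<le> t"
    and "\<And>r. r < v \<Longrightarrow> regs s r \<le> M" "\<And>a. mem s a \<le> M" "2 \<le> M" "M ^ v < 2 ^ b"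
    and "fits_words b s"
  shows "\<exists>R. reach P b s (elen e) (s\<lparr>pc := pc s + elen e, regs := R\<rparr>) \<and>
           (\<forall>r<t. R r = regs s r) \<and> R t = val e (regs s) (mem s)"
  using assms(1-5,8)
proof (induction e arbitrary: s t)
  have val_small: "val e (regs s) (mem s) < 2 ^ b"
    if "esize e \<le> v" "\<And>r. r < v \<Longrightarrow> regs s r \<le> M" "\<And>a. mem s a \<le> M" for e s
  proof -
    have "val e (regs s) (mem s) \<le> M ^ esize e"
      using that assms(6) by (intro val_le) auto
    also have "\<dots> \<le> M ^ v" using assms(6) that(1) by (intro power_increasing) auto
    finally show ?thesis using assms(7) by simp
  qed
  {
    case (Lit k)
    define R where "R = (regs s)(t := k)"
    have "k < 2 ^ b" using val_small[of "Lit k" s] Lit by simp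
    then have "reach P b s (Suc 0) (s\<lparr>pc := pc s + 1, regs := R\<rparr>)"
      using Lit by (intro reach_snoc[OF reach_refl]) (auto simp: R_def set_reg_def fits_words_def)
    moreover have "\<forall>r<t. R r = regs s r" "R t = k" by (auto simp: R_def)
    ultimately show ?case by (intro exI[of _ R]) simp
  next
    case (Var x)
    let ?s1 = "s\<lparr>pc := pc s + 1, regs := (regs s)(t := 0)\<rparr>"
    define R where "R = (regs s)(t := regs s x)"
    let ?s2 = "s\<lparr>pc := pc s + 2, regs := R\<rparr>"
    have x: "x < t" using Var by simp
    have 1: "reach P b s (Suc 0) ?s1"
      using Var by (intro reach_snoc[OF reach_refl]) (auto simp: set_reg_def fits_words_def)
    have "reach P b s (Suc (Suc 0)) ?s2"
      using Var x by (intro reach_snoc[OF 1]) (auto simp: R_def set_reg_def fits_words_def)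
    moreover have "\<forall>r<t. R r = regs s r" "R t = regs s x" by (auto simp: R_def)
    ultimately show ?case by (intro exI[of _ R]) (simp add: numeral_2_eq_2)
  next
    case (Bin f d e)
    have "\<exists>R. reach P b s (elen d) (s\<lparr>pc := pc s + elen d, regs := R\<rparr>) \<and>
           (\<forall>r<t. R r = regs s r) \<and> R t = val d (regs s) (mem s)"
    proof (rule Bin.IH(1)[of s t])
      show "code_at P (pc s) (compile_exp t d)" "esize d \<le> v" "v \<le> t" "fits_words b s"
        using Bin.prems by simp_all
    qed (use Bin.prems(4,5) in blast)+
    then obtain R1 where R1: "reach P b s (elen d) (s\<lparr>pc := pc s + elen d, regs := R1\<rparr>)"
      "\<forall>r<t. R1 r = regs s r" "R1 t = val d (regs s) (mem s)" by blast
    let ?s1 = "s\<lparr>pc := pc s + elen d, regs := R1\<rparr>"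
    have "\<exists>R. reach P b ?s1 (elen e) (?s1\<lparr>pc := pc ?s1 + elen e, regs := R\<rparr>) \<and>
           (\<forall>r<Suc t. R r = regs ?s1 r) \<and> R (Suc t) = val e (regs ?s1) (mem ?s1)"
    proof (rule Bin.IH(2)[of ?s1 "Suc t"])
      show "code_at P (pc ?s1) (compile_exp (Suc t) e)" "esize e \<le> v" "v \<le> Suc t"
        using Bin.prems by simp_all
      show "fits_words b ?s1" using reach_fits[OF R1(1)] .
      show "regs ?s1 r \<le> M" if "r < v" for r
        using that Bin.prems(3) Bin.prems(4)[of r] R1(2) by simp
      show "mem ?s1 a \<le> M" for a using Bin.prems(5)[of a] by simp
    qed
    then obtain R2 where R2: "reach P b ?s1 (elen e) (?s1\<lparr>pc := pc ?s1 + elen e, regs := R2\<rparr>)"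
      "\<forall>r<Suc t. R2 r = R1 r" "R2 (Suc t) = val e R1 (mem s)" by fastforce
    have e: "val e R1 (mem s) = val e (regs s) (mem s)"
      using R1(2) Bin.prems(2,3) by (intro val_cong) auto
    let ?s2 = "s\<lparr>pc := pc s + elen d + elen e, regs := R2\<rparr>"
    let ?z = "apply_binop f (val d (regs s) (mem s)) (val e (regs s) (mem s))"
    define R3 where "R3 = R2(t := ?z)"
    let ?s3 = "s\<lparr>pc := pc s + elen (Bin f d e), regs := R3\<rparr>"
    have 2: "reach P b s (elen d + elen e) ?s2"
      using reach_trans[OF R1(1) R2(1)] by simp
    have z: "?z < 2 ^ b" using val_small[of "Bin f d e" s] Bin.prems by simp
    have "reach P b s (Suc (elen d + elen e)) ?s3"
      using Bin.prems z R1 R2 e reach_fits[OF 2]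
      by (intro reach_snoc[OF 2]) (auto simp: R3_def set_reg_def fits_words_def add.assoc)
    moreover have "\<forall>r<t. R3 r = regs s r" "R3 t = ?z" using R1(2) R2(2) by (auto simp: R3_def)
    ultimately show ?case by (intro exI[of _ R3]) simp
  next
    case (Cell e)
    have "\<exists>R. reach P b s (elen e) (s\<lparr>pc := pc s + elen e, regs := R\<rparr>) \<and>
           (\<forall>r<t. R r = regs s r) \<and> R t = val e (regs s) (mem s)"
    proof (rule Cell.IH[of s t])
      show "code_at P (pc s) (compile_exp t e)" "esize e \<le> v" "v \<le> t" "fits_words b s"
        using Cell.prems by simp_all
    qed (use Cell.prems(4,5) in blast)+
    then obtain R1 where R1: "reach P b s (elen e) (s\<lparr>pc := pc s + elen e, regs := R1\<rparr>)"
      "\<forall>r<t. R1 r = regs s r" "R1 t = val e (regs s) (mem s)" by blast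
    let ?z = "mem s (val e (regs s) (mem s))"
    define R3 where "R3 = R1(t := ?z)"
    let ?s3 = "s\<lparr>pc := pc s + elen (Cell e), regs := R3\<rparr>"
    have z: "?z < 2 ^ b" using Cell.prems by (simp add: fits_words_def)
    have "reach P b s (Suc (elen e)) ?s3"
      using Cell.prems z R1 reach_fits[OF R1(1)]
      by (intro reach_snoc[OF R1(1)]) (auto simp: R3_def set_reg_def fits_words_def)
    moreover have "\<forall>r<t. R3 r = regs s r" "R3 t = ?z" using R1(2) by (auto simp: R3_def)
    ultimately show ?case by (intro exI[of _ R3]) simp
  }
qed

definition represents :: "nat \<Rightarrow> nat \<Rightarrow> nat \<Rightarrow> config \<Rightarrow> state \<Rightarrow> bool" where
  "represents v M b s S \<longleftrightarrow>
    (\<forall>r<v. regs s r = fst S r \<and> fst S r \<le> M) \<and> mem s = snd S \<and> (\<forall>a. snd S a \<le> M) \<and>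
    fits_words b s"

lemma compile_test:
  assumes "code_at P (pc s) (compile_exp v e @ [Const (Suc v) 0, JumpEq v (Suc v) l])"
    and "represents v M b s (R, m)" "esize e \<le> v" "2 \<le> M" "M ^ v < 2 ^ b"
  shows "\<exists>s'. reach P b s (elen e + 2) s' \<and> represents v M b s' (R, m) \<and>
    pc s' = (if val e R m = 0 then l else pc s + elen e + 2)"
proof -
  have r: "\<And>r. r < v \<Longrightarrow> regs s r = R r" "\<And>r. r < v \<Longrightarrow> R r \<le> M" "mem s = m"
    "\<And>a. m a \<le> M" "fits_words b s"
    using assms(2) by (auto simp: represents_def)
  have v: "val e (regs s) m = val e R m" using r(1) assms(3) by (intro val_cong) auto
  have "\<exists>R'. reach P b s (elen e) (s\<lparr>pc := pc s + elen e, regs := R'\<rparr>) \<and>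
           (\<forall>r<v. R' r = regs s r) \<and> R' v = val e (regs s) (mem s)"
    using assms r by (intro compile_exp_correct[where M = M and v = v]) auto
  then obtain R' where R': "reach P b s (elen e) (s\<lparr>pc := pc s + elen e, regs := R'\<rparr>)"
    "\<forall>r<v. R' r = R r" "R' v = val e R m" using r v by auto
  let ?s1 = "s\<lparr>pc := pc s + elen e + 1, regs := R'(Suc v := 0)\<rparr>"
  let ?s2 = "?s1\<lparr>pc := (if val e R m = 0 then l else pc s + elen e + 2)\<rparr>"
  have 1: "reach P b s (Suc (elen e)) ?s1"
    using assms(1) reach_fits[OF R'(1)]
    by (intro reach_snoc[OF R'(1)]) (auto simp: set_reg_def fits_words_def)
  have 2: "reach P b s (Suc (Suc (elen e))) ?s2"
    using assms(1) reach_fits[OF 1] R'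
    by (intro reach_snoc[OF 1]) (auto simp: fits_words_def)
  moreover have "represents v M b ?s2 (R, m)"
    using reach_fits[OF 2] R' r by (auto simp: represents_def)
  ultimately show ?thesis by (intro exI[of _ ?s2]) auto
qed

lemma compile_jump:
  assumes "P ! pc s = Jump l" "pc s < length P" "represents v M b s S"
  shows "\<exists>s'. reach P b s 1 s' \<and> represents v M b s' S \<and> pc s' = l"
  using reach_one[of b s P] assms
  by (intro exI[of _ "s\<lparr>pc := l\<rparr>"]) (auto simp: represents_def fits_words_def)

text \<open>The simulation. Beyond the bound \<open>M\<close> on the data, the only arithmetic condition is that the size of the
program, used as exponent, keeps \<open>M ^ v\<close> within a word.\<close>

lemma compile_correct:
  assumes "big M c S n S'" "csize c \<le> v" "code_at P (pc s) (compile v (pc s) c)"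
    and "represents v M b s S" "2 \<le> M" "M ^ v < 2 ^ b"
  shows "\<exists>s'. reach P b s n s' \<and> represents v M b s' S' \<and> pc s' = pc s + clen c"
  using assms(1-4)
proof (induction arbitrary: s rule: big.induct)
  case (Skip S)
  then show ?case by (intro exI[of _ s]) (auto intro: reach_refl simp: represents_def)
next
  case (Assign e R m x)
  have r: "\<And>r. r < v \<Longrightarrow> regs s r = R r" "\<And>r. r < v \<Longrightarrow> R r \<le> M" "mem s = m"
    "\<And>a. m a \<le> M" "fits_words b s"
    using Assign by (auto simp: represents_def)
  have v: "val e (regs s) m = val e R m" using r(1) Assign.prems(1) by (intro val_cong) auto
  have "\<exists>R'. reach P b s (elen e) (s\<lparr>pc := pc s + elen e, regs := R'\<rparr>) \<and>
           (\<forall>r<v. R' r = regs s r) \<and> R' v = val e (regs s) (mem s)"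
    using Assign assms(5,6) r by (intro compile_exp_correct[where M = M and v = v]) auto
  then obtain R' where R': "reach P b s (elen e) (s\<lparr>pc := pc s + elen e, regs := R'\<rparr>)"
    "\<forall>r<v. R' r = R r" "R' v = val e R m" using r v by auto
  let ?s1 = "s\<lparr>pc := pc s + elen e + 1, regs := R'(Suc v := 0)\<rparr>"
  let ?s2 = "?s1\<lparr>pc := pc s + elen e + 2, regs := R'(Suc v := 0, x := val e R m)\<rparr>"
  have 1: "reach P b s (Suc (elen e)) ?s1"
    using Assign reach_fits[OF R'(1)]
    by (intro reach_snoc[OF R'(1)]) (auto simp: set_reg_def fits_words_def)
  have z: "val e R m < 2 ^ b" using reach_fits[OF R'(1)] R'(3) by (simp add: fits_words_def) metis
  have 2: "reach P b s (Suc (Suc (elen e))) ?s2"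
    using Assign reach_fits[OF 1] R' z
    by (intro reach_snoc[OF 1]) (auto simp: set_reg_def fits_words_def)
  moreover have "represents v M b ?s2 (R(x := val e R m), m)"
    using reach_fits[OF 2] R' r Assign by (auto simp: represents_def)
  ultimately show ?case by (intro exI[of _ ?s2]) auto
next
  case (Write e R m d)
  have r: "\<And>r. r < v \<Longrightarrow> regs s r = R r" "\<And>r. r < v \<Longrightarrow> R r \<le> M" "mem s = m"
    "\<And>a. m a \<le> M" "fits_words b s"
    using Write by (auto simp: represents_def)
  have v: "val d (regs s) m = val d R m" using r(1) Write.prems(1) by (intro val_cong) auto
  have "\<exists>R'. reach P b s (elen d) (s\<lparr>pc := pc s + elen d, regs := R'\<rparr>) \<and>
           (\<forall>r<v. R' r = regs s r) \<and> R' v = val d (regs s) (mem s)"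
    using Write assms(5,6) r by (intro compile_exp_correct[where M = M and v = v]) auto
  then obtain R' where R': "reach P b s (elen d) (s\<lparr>pc := pc s + elen d, regs := R'\<rparr>)"
    "\<forall>r<v. R' r = R r" "R' v = val d R m" using r v by auto
  let ?s1 = "s\<lparr>pc := pc s + elen d, regs := R'\<rparr>"
  have v': "val e R' m = val e R m" using R'(2) Write.prems(1) by (intro val_cong) auto
  have "\<exists>R''. reach P b ?s1 (elen e) (?s1\<lparr>pc := pc ?s1 + elen e, regs := R''\<rparr>) \<and>
           (\<forall>r<Suc v. R'' r = regs ?s1 r) \<and> R'' (Suc v) = val e (regs ?s1) (mem ?s1)"
    using Write assms(5,6) r R' reach_fits[OF R'(1)]
    by (intro compile_exp_correct[where M = M and v = v]) auto
  then obtain R'' where R'': "reach P b ?s1 (elen e) (?s1\<lparr>pc := pc ?s1 + elen e, regs := R''\<rparr>)"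
    "\<forall>r<Suc v. R'' r = R' r" "R'' (Suc v) = val e R m" using r v' by auto
  let ?s2 = "s\<lparr>pc := pc s + elen d + elen e, regs := R''\<rparr>"
  let ?s3 = "?s2\<lparr>pc := pc s + elen d + elen e + 1, mem := m(val d R m := val e R m)\<rparr>"
  have 1: "reach P b s (elen d + elen e) ?s2"
    using reach_trans[OF R'(1) R''(1)] by simp
  have z: "val e R m < 2 ^ b" using reach_fits[OF 1] R''(3) by (simp add: fits_words_def) metis
  have 2: "reach P b s (Suc (elen d + elen e)) ?s3"
    using Write reach_fits[OF 1] R' R'' r z
    by (intro reach_snoc[OF 1]) (auto simp: fits_words_def add.assoc)
  moreover have "represents v M b ?s3 (R, m(val d R m := val e R m))"
    using reach_fits[OF 2] R' R'' r Write by (auto simp: represents_def)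
  ultimately show ?case by (intro exI[of _ ?s3]) auto
next
  case (Seq c S1 t S2 d t' S3)
  obtain s' where s': "reach P b s t s'" "represents v M b s' S2" "pc s' = pc s + clen c"
    using Seq.IH(1)[of s] Seq.prems by auto
  obtain s'' where s'': "reach P b s' t' s''" "represents v M b s'' S3" "pc s'' = pc s' + clen d"
    using Seq.IH(2)[of s'] Seq.prems s' by auto
  show ?case using reach_trans[OF s'(1) s''(1)] s' s'' by (intro exI[of _ s'']) simp
next
  case (CondT e R m c t S' d)
  obtain s1 where s1: "reach P b s (elen e + 2) s1" "represents v M b s1 (R, m)"
    "pc s1 = pc s + elen e + 2"
    using compile_test[of P s v e "pc s + elen e + 2 + clen c + 1" M b R m] CondT assms(5,6) by auto
  obtain s2 where s2: "reach P b s1 t s2" "represents v M b s2 S'" "pc s2 = pc s1 + clen c"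
    using CondT.IH[of s1] CondT.prems s1 by auto
  obtain s3 where s3: "reach P b s2 1 s3" "represents v M b s3 S'"
    "pc s3 = pc s + clen (Cond e c d)"
    using compile_jump[of P s2 "pc s + clen (Cond e c d)" v M b S'] CondT.prems s1 s2
    by (auto simp: add.assoc)
  show ?case
    using reach_trans[OF reach_trans[OF s1(1) s2(1)] s3(1)] s3 by (intro exI[of _ s3]) simp
next
  case (CondF e R m d t S' c)
  obtain s1 where s1: "reach P b s (elen e + 2) s1" "represents v M b s1 (R, m)"
    "pc s1 = pc s + elen e + 2 + clen c + 1"
    using compile_test[of P s v e "pc s + elen e + 2 + clen c + 1" M b R m] CondF assms(5,6) by auto
  obtain s2 where s2: "reach P b s1 t s2" "represents v M b s2 S'" "pc s2 = pc s1 + clen d"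
    using CondF.IH[of s1] CondF.prems s1 by (auto simp: add.assoc)
  show ?case
    using reach_trans[OF s1(1) s2(1)] s1 s2 by (intro exI[of _ s2]) simp
next
  case (WhileT e R m c t S' t' S'')
  obtain s1 where s1: "reach P b s (elen e + 2) s1" "represents v M b s1 (R, m)"
    "pc s1 = pc s + elen e + 2"
    using compile_test[of P s v e "pc s + clen (While e c)" M b R m] WhileT assms(5,6) by auto
  obtain s2 where s2: "reach P b s1 t s2" "represents v M b s2 S'" "pc s2 = pc s1 + clen c"
    using WhileT.IH(1)[of s1] WhileT.prems s1 by auto
  obtain s3 where s3: "reach P b s2 1 s3" "represents v M b s3 S'" "pc s3 = pc s"
    using compile_jump[of P s2 "pc s" v M b S'] WhileT.prems s1 s2
    by (auto simp: add.assoc)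
  obtain s4 where s4: "reach P b s3 t' s4" "represents v M b s4 S''" "pc s4 = pc s3 + clen (While e c)"
    using WhileT.IH(2)[of s3] WhileT.prems s3 by auto
  show ?case
    using reach_trans[OF reach_trans[OF reach_trans[OF s1(1) s2(1)] s3(1)] s4(1)] s3 s4
    by (intro exI[of _ s4]) (simp add: add.assoc)
next
  case (WhileF e R m c)
  then show ?case
    using compile_test[of P s v e "pc s + clen (While e c)" M b R m] assms(5,6) by auto
qed

section \<open>Total correctness with time and word bounds\<close>

definition holds :: "(nat \<Rightarrow> nat) \<Rightarrow> (nat \<Rightarrow> nat) \<Rightarrow> exp \<Rightarrow> bool" where
  "holds R m e \<longleftrightarrow> val e R m \<noteq> 0"

text \<open>A bound on the cost under the assumption that each loop makes at most \<open>N\<close> iterations.\<close>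

primrec ctime :: "nat \<Rightarrow> cmd \<Rightarrow> nat" where
  "ctime N Skip = 0"
| "ctime N (Assign x e) = elen e + 2"
| "ctime N (Write d e) = elen d + elen e + 1"
| "ctime N (Seq c d) = ctime N c + ctime N d"
| "ctime N (Cond e c d) = elen e + 3 + ctime N c + ctime N d"
| "ctime N (While e c) = (elen e + 3 + ctime N c) * N + elen e + 2"

primrec loop_free :: "cmd \<Rightarrow> bool" where
  "loop_free Skip = True"
| "loop_free (Assign x e) = True"
| "loop_free (Write d e) = True"
| "loop_free (Seq c d) = (loop_free c \<and> loop_free d)"
| "loop_free (Cond e c d) = (loop_free c \<and> loop_free d)"
| "loop_free (While e c) = False"

primrec unnested :: "cmd \<Rightarrow> bool" where
  "unnested Skip = True"
| "unnested (Assign x e) = True"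
| "unnested (Write d e) = True"
| "unnested (Seq c d) = (unnested c \<and> unnested d)"
| "unnested (Cond e c d) = (unnested c \<and> unnested d)"
| "unnested (While e c) = loop_free c"

lemma ctime_loop_free: "loop_free c \<Longrightarrow> ctime N c \<le> csize c"
proof (induction c)
  case (Assign x e)
  then show ?case using elen_le_esize[of e] by simp
next
  case (Write d e)
  then show ?case using elen_le_esize[of e] elen_le_esize[of d] by simp
next
  case (Cond e c d)
  then show ?case using elen_le_esize[of e] by simp
qed auto

lemma ctime_unnested: "unnested c \<Longrightarrow> ctime N c \<le> csize c * (N + 1)"
proof (induction c)
  case (Assign x e)
  then show ?case using elen_le_esize[of e] by simp
next
  case (Write d e)
  then show ?case using elen_le_esize[of e] elen_le_esize[of d] by simp
next
  case (Seq c d)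
  then show ?case by (simp add: add_mult_distrib)
next
  case (Cond e c d)
  then show ?case using elen_le_esize[of e] by (simp add: add_mult_distrib)
next
  case (While e c)
  then have "elen e + 3 + ctime N c \<le> csize (While e c)"
    using elen_le_esize[of e] ctime_loop_free[of c N] by simp
  then have "(elen e + 3 + ctime N c) * N \<le> csize (While e c) * N" by (rule mult_le_mono1)
  moreover have "elen e + 2 \<le> csize (While e c)" using elen_le_esize[of e] by simp
  ultimately have "(elen e + 3 + ctime N c) * N + (elen e + 2) \<le> csize (While e c) * N + csize (While e c)"
    by (rule add_mono)
  then show ?case by (simp only: ctime.simps add.assoc distrib_left mult_1_right)
qed auto

definition bounded_state :: "nat \<Rightarrow> (nat \<Rightarrow> nat) \<Rightarrow> (nat \<Rightarrow> nat) \<Rightarrow> bool" where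
  "bounded_state M R m \<longleftrightarrow> (\<forall>r. R r \<le> M) \<and> (\<forall>a. m a \<le> M)"

text \<open>Total correctness from the given state: termination within \<open>ctime N c\<close> steps, with data at most \<open>M\<close>,
in a state satisfying \<open>Q\<close>.\<close>

definition ok :: "nat \<Rightarrow> nat \<Rightarrow> cmd \<Rightarrow> (nat \<Rightarrow> nat) \<Rightarrow> (nat \<Rightarrow> nat) \<Rightarrow>
    ((nat \<Rightarrow> nat) \<Rightarrow> (nat \<Rightarrow> nat) \<Rightarrow> bool) \<Rightarrow> bool" where
  "ok M N c R m Q \<longleftrightarrow>
    (\<exists>t R' m'. big M c (R, m) t (R', m') \<and> t \<le> ctime N c \<and> Q R' m')"

lemma big_bounded:
  "big M c S t S' \<Longrightarrow> bounded_state M (fst S) (snd S) \<Longrightarrow> bounded_state M (fst S') (snd S')"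
  by (induction rule: big.induct) (auto simp: bounded_state_def)

lemma ok_mono:
  assumes "ok M N c R m Q" "bounded_state M R m"
    and "\<And>R' m'. Q R' m' \<Longrightarrow> bounded_state M R' m' \<Longrightarrow> Q' R' m'"
  shows "ok M N c R m Q'"
  using assms big_bounded unfolding ok_def by fastforce

lemma ok_Seq:
  assumes "ok M N c R m Q" "bounded_state M R m"
    and "\<And>R' m'. Q R' m' \<Longrightarrow> bounded_state M R' m' \<Longrightarrow> ok M N d R' m' Q'"
  shows "ok M N (Seq c d) R m Q'"
proof -
  obtain t R' m' where 1: "big M c (R, m) t (R', m')" "t \<le> ctime N c" "Q R' m'"
    using assms(1) by (auto simp: ok_def)
  then have "bounded_state M R' m'" using big_bounded[OF 1(1)] assms(2) by simp
  then obtain t' R'' m'' where "big M d (R', m') t' (R'', m'')" "t' \<le> ctime N d" "Q' R'' m''"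
    using assms(3)[OF 1(3)] by (auto simp: ok_def)
  then show ?thesis
    unfolding ok_def using big.Seq[OF 1(1)] 1(2) by (fastforce intro: add_mono)
qed

lemma ok_Cond:
  assumes "holds R m e \<Longrightarrow> ok M N c R m Q" "\<not> holds R m e \<Longrightarrow> ok M N d R m Q"
  shows "ok M N (Cond e c d) R m Q"
proof (cases "val e R m = 0")
  case True
  then obtain t R' m' where t: "big M d (R, m) t (R', m')" "t \<le> ctime N d" "Q R' m'"
    using assms(2) by (auto simp: ok_def holds_def)
  have "big M (Cond e c d) (R, m) (elen e + 2 + t) (R', m')" using True t(1) by (rule big.CondF)
  then show ?thesis
    unfolding ok_def using t
    by (intro exI[of _ "elen e + 2 + t"] exI[of _ R'] exI[of _ m']) simp
next
  case False
  then obtain t R' m' where t: "big M c (R, m) t (R', m')" "t \<le> ctime N c" "Q R' m'"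
    using assms(1) by (auto simp: ok_def holds_def)
  have "big M (Cond e c d) (R, m) (elen e + 2 + t + 1) (R', m')" using False t(1) by (rule big.CondT)
  then show ?thesis
    unfolding ok_def using t
    by (intro exI[of _ "elen e + 2 + t + 1"] exI[of _ R'] exI[of _ m']) simp
qed

lemma ok_Skip: "Q R m \<Longrightarrow> ok M N Skip R m Q"
  unfolding ok_def by (metis big.Skip le0)

text \<open>The number \<open>n\<close> of iterations is known in advance, so the invariant can be indexed by the iteration, and
the boundedness of the data is available in the body for free.\<close>

lemma ok_While:
  assumes "bounded_state M R m" "I 0 R m" "n \<le> N"
    and "\<And>j R m. j < n \<Longrightarrow> I j R m \<Longrightarrow> bounded_state M R m \<Longrightarrow>
      holds R m e \<and> ok M N c R m (I (Suc j))"
    and "\<And>R m. I n R m \<Longrightarrow> \<not> holds R m e"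
  shows "ok M N (While e c) R m (I n)"
proof -
  have "\<exists>t R' m'. big M (While e c) (R, m) t (R', m') \<and>
      t \<le> (elen e + 3 + ctime N c) * k + elen e + 2 \<and> I n R' m'"
    if "k \<le> n" "I (n - k) R m" "bounded_state M R m" for k R m
    using that
  proof (induction k arbitrary: R m)
    case 0
    then have "val e R m = 0" using assms(5)[of R m] by (simp add: holds_def)
    then have "big M (While e c) (R, m) (elen e + 2) (R, m)" by (rule big.WhileF)
    then show ?case using 0 by (intro exI[of _ "elen e + 2"] exI[of _ R] exI[of _ m]) simp
  next
    case (Suc k)
    have j: "n - Suc k < n" "Suc (n - Suc k) = n - k" using Suc.prems(1) by auto
    have v: "val e R m \<noteq> 0" and "ok M N c R m (I (n - k))"
      using assms(4)[OF j(1) Suc.prems(2,3)] j(2) by (auto simp: holds_def)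
    then obtain t R' m' where t: "big M c (R, m) t (R', m')" "t \<le> ctime N c" "I (n - k) R' m'"
      by (auto simp: ok_def)
    have "bounded_state M R' m'" using big_bounded[OF t(1)] Suc.prems(3) by simp
    then obtain t' R'' m'' where t': "big M (While e c) (R', m') t' (R'', m'')"
      "t' \<le> (elen e + 3 + ctime N c) * k + elen e + 2" "I n R'' m''"
      using Suc.IH[of R' m'] t(3) Suc.prems(1) by auto
    have "big M (While e c) (R, m) (elen e + 2 + t + 1 + t') (R'', m'')"
      using v t(1) t'(1) by (rule big.WhileT)
    moreover have "elen e + 2 + t + 1 + t' \<le> (elen e + 3 + ctime N c) * Suc k + elen e + 2"
      using t(2) t'(2) by simp
    ultimately show ?case using t'(3) by blast
  qed
  from this[of n R m] obtain t R' m' where t: "big M (While e c) (R, m) t (R', m')"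
    "t \<le> (elen e + 3 + ctime N c) * n + elen e + 2" "I n R' m'"
    using assms(1,2) by auto
  have "(elen e + 3 + ctime N c) * n \<le> (elen e + 3 + ctime N c) * N"
    using assms(3) by (rule mult_le_mono2)
  then have "t \<le> ctime N (While e c)" unfolding ctime.simps using t(2) by linarith
  then show ?thesis unfolding ok_def using t by blast
qed

text \<open>Weakest preconditions of straight-line code, for symbolic execution by rewriting. The value \<open>False\<close> for
loops is sound; loops are the business of \<open>ok_While\<close>.\<close>

primrec wp :: "nat \<Rightarrow> cmd \<Rightarrow> ((nat \<Rightarrow> nat) \<Rightarrow> (nat \<Rightarrow> nat) \<Rightarrow> bool) \<Rightarrow>
    (nat \<Rightarrow> nat) \<Rightarrow> (nat \<Rightarrow> nat) \<Rightarrow> bool" where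
  "wp M Skip Q R m = Q R m"
| "wp M (Assign x e) Q R m = (val e R m \<le> M \<and> Q (R(x := val e R m)) m)"
| "wp M (Write d e) Q R m = (val e R m \<le> M \<and> Q R (m(val d R m := val e R m)))"
| "wp M (Seq c d) Q R m = wp M c (wp M d Q) R m"
| "wp M (Cond e c d) Q R m = (if holds R m e then wp M c Q R m else wp M d Q R m)"
| "wp M (While e c) Q R m = False"

lemma wp_ok: "bounded_state M R m \<Longrightarrow> wp M c Q R m \<Longrightarrow> ok M N c R m Q"
proof (induction c arbitrary: Q R m)
  case Skip
  then show ?case by (intro ok_Skip) simp
next
  case (Assign x e)
  then have "big M (Assign x e) (R, m) (elen e + 2) (R(x := val e R m), m)"
    by (intro big.Assign) simp
  then show ?case using Assign unfolding ok_def by fastforce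
next
  case (Write d e)
  then have "big M (Write d e) (R, m) (elen d + elen e + 1) (R, m(val d R m := val e R m))"
    by (intro big.Write) simp
  then show ?case using Write unfolding ok_def by fastforce
next
  case (Seq c d)
  have "ok M N c R m (wp M d Q)" using Seq by simp
  then show ?case using Seq.prems(1) by (rule ok_Seq) (rule Seq.IH(2))
next
  case (Cond e c d)
  then show ?case by (intro ok_Cond) auto
qed simp

lemma csize_pos: "0 < csize c"
  by (induction c) auto

lemma length_less_word: "length xs + 1 \<le> 2 ^ (floor_log (length xs) + 1)"
proof (cases "length xs = 0")
  case False
  then show ?thesis using floor_log_exp2_gt[of "length xs"] by simp
qed simp

text \<open>All constants come from \<open>v = csize c\<close>. Since \<open>N + 2 \<le> length xs + 1 \<le> 2 ^ (\<lfloor>log\<^sub>2 (length xs)\<rfloor> + 1)\<close>, words of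
\<open>v + 1\<close> times the logarithmic length exceed \<open>(N + 2) ^ v\<close>, the bound on intermediate results.\<close>

theorem compiled_program_decides:
  assumes "unnested c"
    and ok: "ok (N + 2) N c (\<lambda>_. 0) (mem (init xs)) (\<lambda>R m. R 0 = (if ans then 1 else 0))"
    and len: "N + 1 \<le> length xs" and xs: "\<And>x. x \<in> set xs \<Longrightarrow> x \<le> N + 2"
  shows "decides_within (compile (csize c) 0 c) (csize c + 1) xs (csize c * (N + 1)) ans"
proof -
  define v where "v = csize c"
  define P where "P = compile v 0 c"
  define b where "b = word_bits (v + 1) xs"
  have "N + 2 \<le> 2 ^ (floor_log (length xs) + 1)" using length_less_word[of xs] len by linarith
  then have "(N + 2) ^ (v + 1) \<le> (2 ^ (floor_log (length xs) + 1)) ^ (v + 1)"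
    by (rule power_mono) simp
  also have "\<dots> = 2 ^ b" by (simp only: b_def word_bits_def power_mult[symmetric] mult.commute)
  finally have M: "(N + 2) ^ (v + 1) \<le> 2 ^ b" .
  have Mv: "(N + 2) ^ v < 2 ^ b"
    by (rule less_le_trans[OF _ M]) simp
  have M1: "N + 2 < 2 ^ b"
  proof -
    have "(N + 2) ^ 1 \<le> (N + 2) ^ v"
      using csize_pos[of c] by (intro power_increasing) (auto simp: v_def)
    then show ?thesis using Mv by simp
  qed
  have mem_le: "mem (init xs) a \<le> N + 2" for a
    using xs[of "xs ! a"] by (simp add: init_def)
  have fits: "fits_words b (init xs)"
    unfolding fits_words_def
  proof (intro conjI allI)
    show "regs (init xs) r < 2 ^ b" for r by (simp add: init_def)
    show "mem (init xs) a < 2 ^ b" for a using mem_le[of a] M1 by linarith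
  qed
  obtain t R m where t: "big (N + 2) c (\<lambda>_. 0, mem (init xs)) t (R, m)" "t \<le> ctime N c"
    "R 0 = (if ans then 1 else 0)"
    using ok by (auto simp: ok_def)
  have "\<exists>s'. reach P b (init xs) t s' \<and> represents v (N + 2) b s' (R, m) \<and>
      pc s' = pc (init xs) + clen c"
  proof (rule compile_correct[OF t(1)])
    show "csize c \<le> v" by (simp add: v_def)
    show "code_at P (pc (init xs)) (compile v (pc (init xs)) c)"
      by (simp add: P_def init_def code_at_def)
    show "represents v (N + 2) b (init xs) (\<lambda>_. 0, mem (init xs))"
      using fits mem_le by (simp add: represents_def init_def)
  qed (use Mv in auto)
  then obtain s' where s': "reach P b (init xs) t s'" "represents v (N + 2) b s' (R, m)"
    "pc s' = clen c" by (auto simp: init_def)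
  have run: "run P xs t = s'" using s'(1) by (simp add: reach_def run_def)
  have "halted P (run P xs t)" 
    unfolding run halted_def using s'(3) by (simp add: P_def)
  moreover have "\<forall>t'\<le>t. fits_words b (run P xs t')" using s'(1) by (simp add: reach_def run_def)
  moreover have "regs (run P xs t) 0 = (if ans then 1 else 0)"

    unfolding run using s'(2) t(3) csize_pos[of c] by (simp add: represents_def v_def)
  moreover have "t \<le> csize c * (N + 1)" using t(2) ctime_unnested[OF assms(1), of N] by linarith
  ultimately show ?thesis unfolding decides_within_def b_def P_def v_def by blast
qed

section \<open>Generalized Petersen graphs as labelled graphs\<close>

lemma edge_UU: "{U i, U j} \<in> gp_edges n k \<longleftrightarrow>
    i < n \<and> j = (i + 1) mod n \<or> j < n \<and> i = (j + 1) mod n"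
  by (auto simp: gp_edges_def doubleton_eq_iff)

lemma edge_UW: "{U i, W j} \<in> gp_edges n k \<longleftrightarrow> i = j \<and> i < n"
  by (auto simp: gp_edges_def doubleton_eq_iff)

lemma edge_WU: "{W i, U j} \<in> gp_edges n k \<longleftrightarrow> i = j \<and> i < n"
  by (auto simp: gp_edges_def doubleton_eq_iff)

lemma edge_WW: "{W i, W j} \<in> gp_edges n k \<longleftrightarrow>
    i < n \<and> j = (i + k) mod n \<or> j < n \<and> i = (j + k) mod n"
  by (auto simp: gp_edges_def doubleton_eq_iff)

lemmas edge_simps = edge_UU edge_UW edge_WU edge_WW

definition gp_embedding :: "(nat \<Rightarrow> nat \<Rightarrow> bool) \<Rightarrow> nat \<Rightarrow> nat \<Rightarrow> nat \<Rightarrow> (gp_vertex \<Rightarrow> nat) \<Rightarrow> bool" where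
  "gp_embedding adj N n k \<phi> \<longleftrightarrow> bij_betw \<phi> (gp_verts n) {..<N} \<and>
     (\<forall>x\<in>gp_verts n. \<forall>y\<in>gp_verts n. {x, y} \<in> gp_edges n k \<longleftrightarrow> adj (\<phi> x) (\<phi> y))"

lemma is_generalized_Petersen_iff:
  assumes "adjacency_lists V E L"
  shows "is_generalized_Petersen V E \<longleftrightarrow>
    (\<exists>n k \<phi>. 3 \<le> n \<and> 1 \<le> k \<and> 2 * k < n \<and>
       gp_embedding (\<lambda>v z. v < length L \<and> z \<in> set (L ! v)) (length L) n k \<phi>)"
proof -
  obtain vs where vs: "distinct vs" "set vs = V" "length vs = length L"
    "\<And>i. i < length L \<Longrightarrow> set (L ! i) = {j. j < length L \<and> {vs ! i, vs ! j} \<in> E}"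
    using assms unfolding adjacency_lists_def by blast
  let ?I = "{..<length L}"
  have bv: "bij_betw ((!) vs) ?I V" using vs by (intro bij_betw_nth) auto
  have E: "j \<in> set (L ! i) \<longleftrightarrow> {vs ! i, vs ! j} \<in> E" if "i \<in> ?I" "j \<in> ?I" for i j
    using vs(4) that by auto
  have "graph_isomorphic V E (gp_verts n) (gp_edges n k) \<longleftrightarrow>
    (\<exists>\<phi>. gp_embedding (\<lambda>v z. v < length L \<and> z \<in> set (L ! v)) (length L) n k \<phi>)" (is "?l \<longleftrightarrow> ?r") for n k
  proof
    assume ?l
    then obtain f where f: "bij_betw f V (gp_verts n)"
      "\<And>x y. x \<in> V \<Longrightarrow> y \<in> V \<Longrightarrow> {x, y} \<in> E \<longleftrightarrow> {f x, f y} \<in> gp_edges n k"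
      unfolding graph_isomorphic_def by blast
    define \<phi> where "\<phi> = inv_into ?I (f \<circ> (!) vs)"
    have b: "bij_betw (f \<circ> (!) vs) ?I (gp_verts n)" using bv f(1) by (rule bij_betw_trans)
    then have \<phi>: "bij_betw \<phi> (gp_verts n) ?I" unfolding \<phi>_def by (rule bij_betw_inv_into)
    have i: "\<phi> x \<in> ?I" "f (vs ! \<phi> x) = x" if "x \<in> gp_verts n" for x
      using that \<phi> b bij_betw_inv_into_right[OF b that] by (auto simp: bij_betw_def \<phi>_def)
    have V: "vs ! i \<in> V" if "i \<in> ?I" for i using that bv by (auto simp: bij_betw_def)
    have "{x, y} \<in> gp_edges n k \<longleftrightarrow> \<phi> y \<in> set (L ! \<phi> x)"
      if "x \<in> gp_verts n" "y \<in> gp_verts n" for x y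
    proof -
      have "\<phi> y \<in> set (L ! \<phi> x) \<longleftrightarrow> {vs ! \<phi> x, vs ! \<phi> y} \<in> E" using that i by (intro E) auto
      also have "\<dots> \<longleftrightarrow> {f (vs ! \<phi> x), f (vs ! \<phi> y)} \<in> gp_edges n k"
        using that i V by (intro f(2)) auto
      finally show ?thesis using i that by simp
    qed
    then show ?r unfolding gp_embedding_def using \<phi> i(1) by blast
  next
    assume ?r
    then obtain \<phi> where \<phi>: "bij_betw \<phi> (gp_verts n) ?I"
      "\<And>x y. x \<in> gp_verts n \<Longrightarrow> y \<in> gp_verts n \<Longrightarrow> {x, y} \<in> gp_edges n k \<longleftrightarrow> \<phi> y \<in> set (L ! \<phi> x)"
      unfolding gp_embedding_def by (fastforce simp: bij_betw_def)
    have b: "bij_betw ((!) vs \<circ> \<phi>) (gp_verts n) V" using \<phi>(1) bv by (rule bij_betw_trans)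
    define f where "f = inv_into (gp_verts n) ((!) vs \<circ> \<phi>)"
    have f: "bij_betw f V (gp_verts n)" unfolding f_def using b by (rule bij_betw_inv_into)
    have i: "f x \<in> gp_verts n" "vs ! \<phi> (f x) = x" "\<phi> (f x) \<in> ?I" if "x \<in> V" for x
      using that f \<phi>(1) bij_betw_inv_into_right[OF b that] by (auto simp: bij_betw_def f_def)
    have "{x, y} \<in> E \<longleftrightarrow> {f x, f y} \<in> gp_edges n k" if "x \<in> V" "y \<in> V" for x y
    proof -
      have "{f x, f y} \<in> gp_edges n k \<longleftrightarrow> \<phi> (f y) \<in> set (L ! \<phi> (f x))"
        using that i by (intro \<phi>(2)) auto
      also have "\<dots> \<longleftrightarrow> {vs ! \<phi> (f x), vs ! \<phi> (f y)} \<in> E" using that i by (intro E) auto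
      finally show ?thesis using i that by simp
    qed
    then show ?l unfolding graph_isomorphic_def using f by blast
  qed
  then show ?thesis unfolding is_generalized_Petersen_def by blast
qed

text \<open>It suffices to check that edges go to edges: a vertex already has its three neighbours among the images, so
a graph of maximum degree three has no room for further edges.\<close>

lemma gp_embedding_if_edges:
  assumes n: "3 \<le> n" and k: "1 \<le> k" "2 * k < n"
    and bij: "bij_betw \<phi> (gp_verts n) {..<N}"
    and deg: "\<And>v. v < N \<Longrightarrow> finite {z. adj v z} \<and> card {z. adj v z} \<le> 3"
    and sym: "\<And>v z. adj v z \<Longrightarrow> adj z v"
    and edges: "\<And>i. i < n \<Longrightarrow> adj (\<phi> (U i)) (\<phi> (U ((i + 1) mod n))) \<and>
      adj (\<phi> (U i)) (\<phi> (W i)) \<and> adj (\<phi> (W i)) (\<phi> (W ((i + k) mod n)))"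
  shows "gp_embedding adj N n k \<phi>"
proof -
  have imp: "adj (\<phi> x) (\<phi> y)" if "{x, y} \<in> gp_edges n k" for x y
    using that edges sym unfolding gp_edges_def by (auto simp: doubleton_eq_iff)
  have three: "\<exists>S. S \<subseteq> gp_verts n \<and> card S = 3 \<and> (\<forall>y\<in>S. {x, y} \<in> gp_edges n k)"
    if x: "x \<in> gp_verts n" for x
  proof -
    have mod_eq: "a mod n = (if a < n then a else a - n)" if "a < 2 * n" for a
      using that by (auto simp: le_mod_geq)
    from x consider i where "x = U i" "i < n" | i where "x = W i" "i < n"
      by (auto simp: gp_verts_def)
    then show ?thesis
    proof cases
      case 1
      let ?S = "{U ((i + 1) mod n), U ((i + (n - 1)) mod n), W i}"
      have "(i + 1) mod n \<noteq> (i + (n - 1)) mod n" "((i + (n - 1)) mod n + 1) mod n = i"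
        using 1 n by (auto simp: mod_eq split: if_splits)
      then have "card ?S = 3" "\<forall>y\<in>?S. {x, y} \<in> gp_edges n k"
        using 1 n by (auto simp: edge_simps)
      moreover have "?S \<subseteq> gp_verts n" using 1 n by (auto simp: gp_verts_def)
      ultimately show ?thesis by blast
    next
      case 2
      let ?S = "{W ((i + k) mod n), W ((i + (n - k)) mod n), U i}"
      have "(i + k) mod n \<noteq> (i + (n - k)) mod n" "((i + (n - k)) mod n + k) mod n = i"
        using 2 n k by (auto simp: mod_eq split: if_splits)
      then have "card ?S = 3" "\<forall>y\<in>?S. {x, y} \<in> gp_edges n k"
        using 2 n by (auto simp: edge_simps)
      moreover have "?S \<subseteq> gp_verts n" using 2 n by (auto simp: gp_verts_def)
      ultimately show ?thesis by blast
    qed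
  qed
  have "{x, y} \<in> gp_edges n k" if x: "x \<in> gp_verts n" and y: "y \<in> gp_verts n"
    and a: "adj (\<phi> x) (\<phi> y)" for x y
  proof -
    obtain S where S: "S \<subseteq> gp_verts n" "card S = 3" "\<forall>y\<in>S. {x, y} \<in> gp_edges n k"
      using three[OF x] by blast
    have inj: "inj_on \<phi> (gp_verts n)" using bij by (simp add: bij_betw_def)
    have "\<phi> x < N" using bij x by (auto simp: bij_betw_def)
    then have "\<phi> ` S = {z. adj (\<phi> x) z}"
      using deg[of "\<phi> x"] S imp card_image[OF inj_on_subset[OF inj S(1)]]
      by (intro card_seteq) auto
    then obtain y' where "y' \<in> S" "\<phi> y = \<phi> y'" using a by auto
    then have "y = y'" using inj y S(1) by (auto simp: inj_on_def)
    then show ?thesis using S(3) \<open>y' \<in> S\<close> by simp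
  qed
  then show ?thesis unfolding gp_embedding_def using bij imp by blast
qed

text \<open>A labelling by all integers, periodic modulo \<open>n\<close>. Compared with labels \<open>0, \<dots>, n - 1\<close> it turns adjacency into
plain addition, and coincidences of vertices into divisibility by \<open>n\<close>.\<close>

locale petersen_labelling =
  fixes adj :: "nat \<Rightarrow> nat \<Rightarrow> bool" and N n k :: nat and u w :: "int \<Rightarrow> nat"
  assumes n: "3 \<le> n" and k: "1 \<le> k" "2 * k < n" and N: "N = 2 * n"
    and u_eq: "u x = u y \<longleftrightarrow> int n dvd x - y"
    and w_eq: "w x = w y \<longleftrightarrow> int n dvd x - y"
    and u_neq_w: "u x \<noteq> w y"
    and less: "u x < N" "w x < N"
    and covers: "v < N \<Longrightarrow> (\<exists>x. v = u x) \<or> (\<exists>x. v = w x)"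
    and adj_u: "adj (u x) z \<longleftrightarrow> z = u (x + 1) \<or> z = u (x - 1) \<or> z = w x"
    and adj_w: "adj (w x) z \<longleftrightarrow> z = u x \<or> z = w (x + int k) \<or> z = w (x - int k)"

lemma gp_embedding_imp_labelling:
  assumes n: "3 \<le> n" and k: "1 \<le> k" "2 * k < n" and \<phi>: "gp_embedding adj N n k \<phi>"
    and adj: "\<And>v z. v < N \<Longrightarrow> adj v z \<Longrightarrow> z < N"
  shows "petersen_labelling adj N n k (\<lambda>x. \<phi> (U (nat (x mod int n)))) (\<lambda>x. \<phi> (W (nat (x mod int n))))"
proof -
  define r where "r x = nat (x mod int n)" for x
  have r: "r x < n" "int (r x) = x mod int n" for x using n by (auto simp: r_def nat_less_iff)
  have r_eq: "r x = r y \<longleftrightarrow> int n dvd x - y" for x y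
    unfolding mod_eq_dvd_iff[symmetric] r(2)[symmetric] by simp
  have r_add: "(r x + j) mod n = r (x + int j)" for x j
  proof -
    have "int ((r x + j) mod n) = int (r (x + int j))"
      by (simp add: zmod_int r(2) mod_simps)
    then show ?thesis by (simp only: of_nat_eq_iff)
  qed
  have r_sub: "r x = r (y + int j) \<longleftrightarrow> r y = r (x - int j)" for x y j
    unfolding r_eq by (metis add.commute diff_add_eq dvd_minus_iff minus_diff_eq diff_diff_eq2)
  have r_id: "r (int i) = i" if "i < n" for i using that by (simp add: r_def)
  have inj: "inj_on \<phi> (gp_verts n)" and im: "\<phi> ` gp_verts n = {..<N}"
    using \<phi> by (auto simp: gp_embedding_def bij_betw_def)
  have mem: "U (r x) \<in> gp_verts n" "W (r x) \<in> gp_verts n" for x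
    using r(1) by (auto simp: gp_verts_def)
  have eq: "\<phi> x = \<phi> y \<longleftrightarrow> x = y" if "x \<in> gp_verts n" "y \<in> gp_verts n" for x y
    using inj that by (auto simp: inj_on_def)
  have lt: "\<phi> x < N" if "x \<in> gp_verts n" for x using im that by auto
  have iff: "adj (\<phi> x) (\<phi> y) \<longleftrightarrow> {x, y} \<in> gp_edges n k" if "x \<in> gp_verts n" "y \<in> gp_verts n" for x y
    using \<phi> that by (auto simp: gp_embedding_def)
  have cover: "(\<exists>x. v = \<phi> (U (r x))) \<or> (\<exists>x. v = \<phi> (W (r x)))" if "v < N" for v
  proof -
    have "v \<in> \<phi> ` gp_verts n" using that im by simp
    then obtain y where "y \<in> gp_verts n" "v = \<phi> y" by blast
    then show ?thesis using r_id by (auto simp: gp_verts_def) (metis r_id)+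
  qed
  have card: "N = 2 * n"
  proof -
    have "card (gp_verts n) = N" using card_image[OF inj] im by simp
    moreover have "card (gp_verts n) = 2 * n"
      unfolding gp_verts_def by (subst card_Un_disjoint) (auto simp: card_image inj_on_def)
    ultimately show ?thesis by simp
  qed
  have adjU: "adj (\<phi> (U (r x))) z \<longleftrightarrow>
      z = \<phi> (U (r (x + 1))) \<or> z = \<phi> (U (r (x - 1))) \<or> z = \<phi> (W (r x))" (is "?l \<longleftrightarrow> ?r") for x z
  proof (cases "z < N")
    case True
    have rs: "(r x + 1) mod n = r (x + 1)" "r x = r (y + 1) \<longleftrightarrow> r y = r (x - 1)" for x y
      using r_add[of x 1] r_sub[of x y 1] by simp_all
    from cover[OF True] show ?thesis
      by (elim disjE exE) (auto simp: iff mem eq edge_simps r(1) rs[unfolded One_nat_def add_Suc_right add_0_right])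
  next
    case False
    then show ?thesis using adj[of "\<phi> (U (r x))" z] lt mem by auto
  qed
  have adjW: "adj (\<phi> (W (r x))) z \<longleftrightarrow>
      z = \<phi> (U (r x)) \<or> z = \<phi> (W (r (x + int k))) \<or> z = \<phi> (W (r (x - int k)))" (is "?l \<longleftrightarrow> ?r") for x z
  proof (cases "z < N")
    case True
    from cover[OF True] show ?thesis
      by (elim disjE exE) (auto simp: iff mem eq edge_simps r(1) r_add r_sub)
  next
    case False
    then show ?thesis using adj[of "\<phi> (W (r x))" z] lt mem by auto
  qed
  show ?thesis
    unfolding r_def[symmetric]
    by unfold_locales (use n k card mem lt cover adjU adjW in \<open>auto simp: eq r_eq\<close>)
qed

context petersen_labelling
begin

text \<open>Rotational symmetry: the walk may start at any outer vertex.\<close>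

lemma labelling_shifted: "petersen_labelling adj N n k (\<lambda>x. u (s + x)) (\<lambda>x. w (s + x))"
proof unfold_locales
  show "(\<exists>x. v = u (s + x)) \<or> (\<exists>x. v = w (s + x))" if "v < N" for v
    using covers[OF that] by (metis add_diff_cancel_left' add.commute diff_add_cancel)
qed (use n k N less in \<open>auto simp: u_eq w_eq u_neq_w adj_u adj_w algebra_simps\<close>)

lemma not_dvd: "\<not> int n dvd d" if "d \<noteq> 0" "\<bar>d\<bar> < int n" for d
  using that by (auto dest: dvd_imp_le_int)

lemma degree: "v < N \<Longrightarrow> card {z. adj v z} = 3"
proof -
  assume "v < N"
  then consider x where "v = u x" | x where "v = w x" using covers by blast
  then show ?thesis
  proof cases
    case 1
    have "{z. adj v z} = {u (x + 1), u (x - 1), w x}" using 1 by (auto simp: adj_u)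
    moreover have "\<not> int n dvd 2" using n by (intro not_dvd) auto
    ultimately show ?thesis by (simp add: u_eq u_neq_w)
  next
    case 2
    have "{z. adj v z} = {u x, w (x + int k), w (x - int k)}" using 2 by (auto simp: adj_w)
    moreover have "\<not> int n dvd 2 * int k" using k by (intro not_dvd) auto
    ultimately show ?thesis by (simp add: w_eq u_neq_w)
  qed
qed

end

section \<open>Telling spokes from rim edges\<close>

text \<open>A walk \<open>c, y, y1, y2, y3, p\<close> without backtracking. Backtracking is excluded because a walk that turns back
reduces to a shorter one, which would give further relations and make the test fail at \<open>k = 3\<close>.\<close>

definition four_path :: "(nat \<Rightarrow> nat \<Rightarrow> bool) \<Rightarrow> nat \<Rightarrow> nat \<Rightarrow> nat \<Rightarrow> bool" where
  "four_path adj c y p \<longleftrightarrow> (\<exists>y1 y2 y3. adj y y1 \<and> y1 \<noteq> c \<and> adj y1 y2 \<and> y2 \<noteq> y \<and>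
     adj y2 y3 \<and> y3 \<noteq> y1 \<and> adj y3 p \<and> p \<noteq> y2)"

definition spoke_test :: "(nat \<Rightarrow> nat \<Rightarrow> bool) \<Rightarrow> nat \<Rightarrow> nat \<Rightarrow> nat \<Rightarrow> nat \<Rightarrow> bool" where
  "spoke_test adj a b c y \<longleftrightarrow> (\<forall>p. adj b p \<longrightarrow> p = a \<or> four_path adj c y p)"

context petersen_labelling
begin

text \<open>The path is the rest of the eight-cycle through \<open>u\<^sub>x, u\<^bsub>x+1\<^esub>, w\<^bsub>x+1\<^esub>, w\<^bsub>x+1+k\<^esub>, u\<^bsub>x+1+k\<^esub>, u\<^bsub>x+k\<^esub>, w\<^bsub>x+k\<^esub>, w\<^sub>x\<close>, or
the same with \<open>- k\<close> for \<open>k\<close>. For \<open>k = 1\<close> that cycle degenerates.\<close>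

lemma spoke_test_spoke:
  assumes "k \<noteq> 1"
  shows "spoke_test adj (u x) (w x) (u (x + 1)) (w (x + 1))"
proof -
  have "four_path adj (u (x + 1)) (w (x + 1)) (w (x + s * int k))" if "s = 1 \<or> s = - 1" for s
  proof -
    let ?y1 = "w (x + 1 + s * int k)" and ?y2 = "u (x + 1 + s * int k)" and ?y3 = "u (x + s * int k)"
    have "adj (w (x + 1)) ?y1" "adj ?y1 ?y2" "adj ?y2 ?y3" "adj ?y3 (w (x + s * int k))"
      using that by (auto simp: adj_u adj_w algebra_simps)
    moreover have "?y1 \<noteq> u (x + 1)" "?y2 \<noteq> w (x + 1)" "?y3 \<noteq> ?y1" "w (x + s * int k) \<noteq> ?y2"
      using u_neq_w by (metis, metis, metis, metis)
    ultimately show ?thesis unfolding four_path_def by blast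
  qed
  from this[of 1] this[of "- 1"] show ?thesis
    unfolding spoke_test_def by (auto simp: adj_w)
qed

lemma straight_u: "adj (u t) q \<Longrightarrow> q \<noteq> u (t - 1) \<Longrightarrow> q = u (t + 1) \<or> q = w t"
  by (auto simp: adj_u)

lemma straight_w:
  assumes "adj (w (t + s * int k)) q" "q \<noteq> w t" "s = 1 \<or> s = - 1"
  shows "q = u (t + s * int k) \<or> q = w (t + 2 * s * int k)"
  using assms by (auto simp: adj_w algebra_simps)

lemma turn_w: "adj (w t) q \<Longrightarrow> q \<noteq> u t \<Longrightarrow> \<exists>s. (s = 1 \<or> s = - 1) \<and> q = w (t + s * int k)"
  by (auto simp: adj_w intro: exI[of _ 1] exI[of _ "- 1"])

text \<open>A path of length four from an outer to an inner vertex uses exactly one spoke, as three spokes would need five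
edges. So it makes some rim steps, crosses, and makes some inner steps, three of these steps in
all; it cannot go back along the rim because it avoids \<open>u\<^bsub>x+1\<^esub>\<close>. The pairs list the possible
net numbers of rim steps and inner steps.\<close>

lemma four_path_relation:
  assumes "four_path adj (u (x + 1)) (u (x + 2)) (w z)"
  shows "\<exists>(\<alpha>, \<beta>) \<in> {(3, 0), (2, 1), (2, - 1), (1, 2), (1, - 2), (0, 3), (0, - 3)}.
    int n dvd x + 2 + \<alpha> + \<beta> * int k - z"
proof -
  obtain y1 y2 y3 where y: "adj (u (x + 2)) y1" "y1 \<noteq> u (x + 1)" "adj y1 y2" "y2 \<noteq> u (x + 2)"
    "adj y2 y3" "y3 \<noteq> y1" "adj y3 (w z)" "w z \<noteq> y2"
    using assms unfolding four_path_def by blast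
  have nw: "w a \<noteq> u b" for a b using u_neq_w[of b a] by simp
  have *: "\<exists>\<alpha> \<beta>. (\<alpha>, \<beta>) \<in> {(3, 0), (2, 1), (2, - 1), (1, 2), (1, - 2), (0, 3), (0, - 3)} \<and>
      w z = w (x + 2 + \<alpha> + \<beta> * int k)"
  proof -
    have "y1 = u (x + 3) \<or> y1 = w (x + 2)" using straight_u[OF y(1)] y(2) by (simp add: algebra_simps)
    then show ?thesis
    proof
      assume y1: "y1 = u (x + 3)"
      then have "y2 = u (x + 4) \<or> y2 = w (x + 3)"
        using straight_u[of "x + 3" y2] y by (simp add: algebra_simps)
      then show ?thesis
      proof
        assume y2: "y2 = u (x + 4)"
        then have "y3 = u (x + 5) \<or> y3 = w (x + 4)"
          using straight_u[of "x + 4" y3] y y1 by (simp add: algebra_simps)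
        then show ?thesis
        proof
          assume "y3 = u (x + 5)"
          then have "w z = w (x + 5)" using y(7) nw by (auto simp: adj_u)
          then show ?thesis by - (rule exI[of _ 3], rule exI[of _ 0], auto simp: algebra_simps)
        next
          assume "y3 = w (x + 4)"
          then obtain s where "s = 1 \<or> s = - 1" "w z = w (x + 4 + s * int k)"
            using turn_w[of "x + 4" "w z"] y(7) nw by auto
          then show ?thesis by - (rule exI[of _ 2], rule exI[of _ s], auto simp: algebra_simps)
        qed
      next
        assume y2: "y2 = w (x + 3)"
        then obtain s where s: "s = 1 \<or> s = - 1" and y3: "y3 = w (x + 3 + s * int k)"
          using turn_w[of "x + 3" y3] y y1 by auto
        then have "w z = w (x + 3 + 2 * s * int k)"
          using straight_w[of "x + 3" s "w z"] y y2 nw by auto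
        then show ?thesis using s by - (rule exI[of _ 1], rule exI[of _ "2 * s"], auto simp: algebra_simps)
      qed
    next
      assume y1: "y1 = w (x + 2)"
      then obtain s where s: "s = 1 \<or> s = - 1" and y2: "y2 = w (x + 2 + s * int k)"
        using turn_w[of "x + 2" y2] y by auto
      then have "y3 = u (x + 2 + s * int k) \<or> y3 = w (x + 2 + 2 * s * int k)"
        using straight_w[of "x + 2" s y3] y y1 by auto
      moreover have "y3 \<noteq> u (x + 2 + s * int k)"
        using y(7,8) y2 nw by (auto simp: adj_u)
      ultimately have y3: "y3 = w ((x + 2 + s * int k) + s * int k)" by (auto simp: algebra_simps)
      have "w z = w (x + 2 + s * int k + 2 * s * int k)"
        using straight_w[of "x + 2 + s * int k" s "w z"] s y(7,8) y2 y3 nw by auto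
      then show ?thesis
        using s by - (rule exI[of _ 0], rule exI[of _ "3 * s"], auto simp: algebra_simps)
    qed
  qed
  then obtain \<alpha> \<beta> where "(\<alpha>, \<beta>) \<in> {(3, 0), (2, 1), (2, - 1), (1, 2), (1, - 2), (0, 3), (0, - 3)}"
    "w (x + 2 + \<alpha> + \<beta> * int k) = w z" by metis
  then show ?thesis unfolding w_eq by blast
qed

text \<open>Eliminating \<open>k\<close> leaves a nonzero multiple of \<open>n\<close> that is too small.\<close>

lemma no_two_relations:
  assumes "int n dvd a + b * int k" "int n dvd c + d * int k" "a * d - c * b \<noteq> 0"
    "\<bar>a * d - c * b\<bar> < int n"
  shows False
proof -
  have "int n dvd (a + b * int k) * d - (c + d * int k) * b"
    using assms(1,2) by (intro dvd_diff dvd_mult2)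
  also have "(a + b * int k) * d - (c + d * int k) * b = a * d - c * b" by (simp add: algebra_simps)
  finally show False using not_dvd assms(3,4) by blast
qed

text \<open>If both inner neighbours of \<open>w\<^sub>x\<close> could be reached, there would be two relations
\<open>(2 + \<alpha>) + (\<beta> - 1) k \<equiv> 0\<close> and \<open>(2 + \<gamma>) + (\<delta> + 1) k \<equiv> 0\<close>. The largest determinant, \<open>22\<close>, belongs to
\<open>(5, -1), (2, 4)\<close> and to \<open>(2, -4), (5, 1)\<close>. The determinant vanishes, apart from the relation \<open>4 \<equiv> 0\<close>, only for
\<open>(3, -3), (2, -2)\<close> and \<open>(2, 2), (3, 3)\<close>, whose differences force \<open>k \<equiv> 1\<close> and \<open>k \<equiv> -1\<close>.\<close>

lemma spoke_test_rim:
  assumes "k \<noteq> 1" "22 < n"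
  shows "\<not> spoke_test adj (u x) (w x) (u (x + 1)) (u (x + 2))"
proof
  assume *: "spoke_test adj (u x) (w x) (u (x + 1)) (u (x + 2))"
  have nw: "w a \<noteq> u b" for a b using u_neq_w[of b a] by simp
  have "four_path adj (u (x + 1)) (u (x + 2)) (w (x + int k))"
    "four_path adj (u (x + 1)) (u (x + 2)) (w (x - int k))"
    using * nw unfolding spoke_test_def by (auto simp: adj_w)
  note four_path_relation[OF this(1)] four_path_relation[OF this(2)]
  then obtain \<alpha> \<beta> \<gamma> \<delta> where
    \<alpha>: "(\<alpha>, \<beta>) \<in> {(3, 0), (2, 1), (2, - 1), (1, 2), (1, - 2), (0, 3), (0, - 3)}" and
    \<gamma>: "(\<gamma>, \<delta>) \<in> {(3, 0), (2, 1), (2, - 1), (1, 2), (1, - 2), (0, 3), (0, - 3)}" and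
    r: "int n dvd x + 2 + \<alpha> + \<beta> * int k - (x + int k)"
      "int n dvd x + 2 + \<gamma> + \<delta> * int k - (x - int k)"
    by blast
  have r1: "int n dvd (2 + \<alpha>) + (\<beta> - 1) * int k" using r(1) by (simp add: algebra_simps)
  have r2: "int n dvd (2 + \<gamma>) + (\<delta> + 1) * int k" using r(2) by (simp add: algebra_simps)
  \<comment> \<open>this pair would make the first relation \<open>4 \<equiv> 0\<close>, without \<open>k\<close>\<close>
  have "(\<alpha>, \<beta>) \<noteq> (2, 1)"
    using r1 not_dvd[of 4] assms(2) by auto
  moreover have "(2 + \<alpha>) * (\<delta> + 1) - (2 + \<gamma>) * (\<beta> - 1) = 0"
  proof (rule ccontr)
    have "\<bar>(2 + \<alpha>) * (\<delta> + 1) - (2 + \<gamma>) * (\<beta> - 1)\<bar> \<le> 22"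
      using \<alpha> \<gamma> unfolding insert_iff empty_iff Pair_inject by (elim disjE conjE FalseE) simp_all
    then show "(2 + \<alpha>) * (\<delta> + 1) - (2 + \<gamma>) * (\<beta> - 1) \<noteq> 0 \<Longrightarrow> False"
      using no_two_relations[OF r1 r2] assms(2) by linarith
  qed
  ultimately have "(\<alpha>, \<beta>) = (1, - 2) \<and> (\<gamma>, \<delta>) = (0, - 3) \<or> (\<alpha>, \<beta>) = (0, 3) \<and> (\<gamma>, \<delta>) = (1, 2)"
    using \<alpha> \<gamma> unfolding insert_iff empty_iff Pair_inject by (elim disjE conjE FalseE) simp_all
  then show False
  proof
    assume "(\<alpha>, \<beta>) = (1, - 2) \<and> (\<gamma>, \<delta>) = (0, - 3)"
    then have "int n dvd 1 - int k" using dvd_diff[OF r1 r2] by simp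
    moreover have "\<not> int n dvd 1 - int k" using assms k by (intro not_dvd) auto
    ultimately show False by simp
  next
    assume "(\<alpha>, \<beta>) = (0, 3) \<and> (\<gamma>, \<delta>) = (1, 2)"
    then have "int n dvd - (1 + int k)" using dvd_diff[OF r1 r2] by simp
    moreover have "\<not> int n dvd - (1 + int k)" using k by (intro not_dvd) auto
    ultimately show False by blast
  qed
qed

lemma prism_test:
  assumes "k = 1"
  shows "adj (w x) (w (x + 1))" and "\<not> adj (w x) (u (x + 2))"
proof -
  have "\<not> int n dvd 2" using n by (intro not_dvd) auto
  then show "adj (w x) (w (x + 1))" "\<not> adj (w x) (u (x + 2))"
    using assms by (auto simp: adj_w u_eq u_neq_w)
qed

end

section \<open>Expressions about the input graph\<close>

text \<open>A condition holds if its value is not \<open>0\<close>. Conjunction is a product, disjunction a sum, and truncated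
subtraction provides the comparisons; values larger than \<open>1\<close> do no harm.\<close>

definition notE :: "exp \<Rightarrow> exp" where "notE d = Bin Sub (Lit 1) d"
definition andE :: "exp \<Rightarrow> exp \<Rightarrow> exp" where "andE = Bin Mul"
definition orE :: "exp \<Rightarrow> exp \<Rightarrow> exp" where "orE = Bin Add"
definition lessE :: "exp \<Rightarrow> exp \<Rightarrow> exp" where "lessE d e = Bin Sub e d"
definition eqE :: "exp \<Rightarrow> exp \<Rightarrow> exp" where "eqE d e = notE (orE (lessE d e) (lessE e d))"

lemma holds_connectives [simp]:
  "holds R m (notE d) \<longleftrightarrow> \<not> holds R m d"
  "holds R m (andE d e) \<longleftrightarrow> holds R m d \<and> holds R m e"
  "holds R m (orE d e) \<longleftrightarrow> holds R m d \<or> holds R m e"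
  "holds R m (lessE d e) \<longleftrightarrow> val d R m < val e R m"
  "holds R m (eqE d e) \<longleftrightarrow> val d R m = val e R m"
  by (auto simp: holds_def notE_def andE_def orE_def lessE_def eqE_def)

text \<open>In a cubic graph every vertex takes four cells, its degree and three neighbours, after the initial cell
with the number of vertices. So neighbours can be addressed directly, without a table of offsets.\<close>

definition nbE :: "exp \<Rightarrow> nat \<Rightarrow> exp" where
  "nbE e d = Cell (Bin Add (Lit (2 + d)) (Bin Mul (Lit 4) e))"

lemma val_nbE: "val (nbE e d) R m = m (2 + d + 4 * val e R m)"
  by (simp add: nbE_def)

text \<open>Quantification over the neighbours of a vertex. The body is a function on expressions and is unrolled three
times, so that tests of bounded radius become single expressions, evaluated in constant time.\<close>

definition exE :: "(exp \<Rightarrow> exp) \<Rightarrow> exp \<Rightarrow> exp" where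
  "exE F e = orE (F (nbE e 0)) (orE (F (nbE e 1)) (F (nbE e 2)))"

definition allE :: "(exp \<Rightarrow> exp) \<Rightarrow> exp \<Rightarrow> exp" where
  "allE F e = notE (exE (\<lambda>y. notE (F y)) e)"

definition adjE :: "exp \<Rightarrow> exp \<Rightarrow> exp" where
  "adjE d e = exE (\<lambda>y. eqE y e) d"

definition four_pathE :: "exp \<Rightarrow> exp \<Rightarrow> exp \<Rightarrow> exp" where
  "four_pathE c y p =
    exE (\<lambda>y1. andE (notE (eqE y1 c))
      (exE (\<lambda>y2. andE (notE (eqE y2 y))
        (exE (\<lambda>y3. andE (notE (eqE y3 y1)) (andE (adjE y3 p) (notE (eqE p y2)))) y2)) y1)) y"

definition spoke_testE :: "exp \<Rightarrow> exp \<Rightarrow> exp \<Rightarrow> exp \<Rightarrow> exp" where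
  "spoke_testE a b c y = allE (\<lambda>p. orE (eqE p a) (four_pathE c y p)) b"

definition adj_of :: "nat list list \<Rightarrow> nat \<Rightarrow> nat \<Rightarrow> bool" where
  "adj_of L v z \<longleftrightarrow> v < length L \<and> z \<in> set (L ! v)"

definition graph_mem :: "nat list list \<Rightarrow> (nat \<Rightarrow> nat) \<Rightarrow> bool" where
  "graph_mem L m \<longleftrightarrow> (\<forall>v<length L. \<forall>d<3. m (2 + d + 4 * v) = L ! v ! d)"

locale cubic_input =
  fixes L :: "nat list list"
  assumes deg: "v < length L \<Longrightarrow> length (L ! v) = 3"
    and bound: "adj_of L v z \<Longrightarrow> z < length L"
    and sym: "adj_of L v z \<Longrightarrow> adj_of L z v"
begin

lemma adj_iff: "v < length L \<Longrightarrow> adj_of L v z \<longleftrightarrow> (\<exists>d<3. L ! v ! d = z)"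
  unfolding adj_of_def by (auto simp: in_set_conv_nth deg)

lemma adj_nth: "v < length L \<Longrightarrow> d < 3 \<Longrightarrow> adj_of L v (L ! v ! d)"
  by (auto simp: adj_iff)

lemma val_nbE_graph:
  "graph_mem L m \<Longrightarrow> val e R m < length L \<Longrightarrow> d < 3 \<Longrightarrow> val (nbE e d) R m = L ! val e R m ! d"
  by (simp add: val_nbE graph_mem_def)

lemma less_3: "(\<exists>d<3::nat. P d) \<longleftrightarrow> P 0 \<or> P 1 \<or> P 2"
  by (auto simp: less_Suc_eq numeral_3_eq_3 numeral_2_eq_2)

lemma holds_exE:
  assumes "graph_mem L m" "val e R m < length L"
    and "\<And>d. val d R m < length L \<Longrightarrow> holds R m (F d) \<longleftrightarrow> P (val d R m)"
  shows "holds R m (exE F e) \<longleftrightarrow> (\<exists>z. adj_of L (val e R m) z \<and> P z)"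
proof -
  have "holds R m (F (nbE e d)) \<longleftrightarrow> P (L ! val e R m ! d)" if "d < 3" for d
    using assms that adj_nth[of "val e R m" d] bound by (simp add: val_nbE_graph)
  then have "holds R m (exE F e) \<longleftrightarrow> (\<exists>d<3. P (L ! val e R m ! d))"
    by (simp add: exE_def less_3)
  then show ?thesis using adj_iff[OF assms(2)] by auto
qed

lemma holds_allE:
  assumes "graph_mem L m" "val e R m < length L"
    and "\<And>d. val d R m < length L \<Longrightarrow> holds R m (F d) \<longleftrightarrow> P (val d R m)"
  shows "holds R m (allE F e) \<longleftrightarrow> (\<forall>z. adj_of L (val e R m) z \<longrightarrow> P z)"
  using holds_exE[OF assms(1,2), of "\<lambda>y. notE (F y)" "\<lambda>z. \<not> P z"] assms(3)
  by (auto simp: allE_def)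

lemma holds_adjE:
  assumes "graph_mem L m" "val d R m < length L"
  shows "holds R m (adjE d e) \<longleftrightarrow> adj_of L (val d R m) (val e R m)"
  unfolding adjE_def
  using holds_exE[OF assms, of "\<lambda>y. eqE y e" "\<lambda>z. z = val e R m"] by auto

lemma holds_four_pathE:
  assumes m: "graph_mem L m" and y: "val y R m < length L"
  shows "holds R m (four_pathE c y p) \<longleftrightarrow> four_path (adj_of L) (val c R m) (val y R m) (val p R m)"
proof -
  let ?adj = "adj_of L" and ?v = "\<lambda>e. val e R m"
  have "holds R m (four_pathE c y p) \<longleftrightarrow> (\<exists>y1. ?adj (?v y) y1 \<and> (y1 \<noteq> ?v c \<and>
    (\<exists>y2. ?adj y1 y2 \<and> (y2 \<noteq> ?v y \<and> (\<exists>y3. ?adj y2 y3 \<and> (y3 \<noteq> y1 \<and> ?adj y3 (?v p) \<and> ?v p \<noteq> y2))))))"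
    unfolding four_pathE_def
  proof (rule holds_exE[OF m y], goal_cases)
    case (1 y1)
    have "holds R m (exE (\<lambda>y2. andE (notE (eqE y2 y))
        (exE (\<lambda>y3. andE (notE (eqE y3 y1)) (andE (adjE y3 p) (notE (eqE p y2)))) y2)) y1) \<longleftrightarrow>
      (\<exists>y2. ?adj (?v y1) y2 \<and> (y2 \<noteq> ?v y \<and> (\<exists>y3. ?adj y2 y3 \<and> (y3 \<noteq> ?v y1 \<and> ?adj y3 (?v p) \<and> ?v p \<noteq> y2))))"
    proof (rule holds_exE[OF m 1], goal_cases)
      case (1 y2)
      have "holds R m (exE (\<lambda>y3. andE (notE (eqE y3 y1)) (andE (adjE y3 p) (notE (eqE p y2)))) y2) \<longleftrightarrow>
        (\<exists>y3. ?adj (?v y2) y3 \<and> (y3 \<noteq> ?v y1 \<and> ?adj y3 (?v p) \<and> ?v p \<noteq> ?v y2))"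
        by (rule holds_exE[OF m 1]) (simp add: holds_adjE m)
      then show ?case by simp
    qed
    then show ?case by simp
  qed
  then show ?thesis unfolding four_path_def by auto
qed

lemma holds_spoke_testE:
  assumes m: "graph_mem L m" and "val b R m < length L" "val y R m < length L"
  shows "holds R m (spoke_testE a b c y) \<longleftrightarrow>
    spoke_test (adj_of L) (val a R m) (val b R m) (val c R m) (val y R m)"
  unfolding spoke_testE_def spoke_test_def
  by (rule holds_allE[OF assms(1,2)]) (simp add: holds_four_pathE assms)

end

section \<open>Walking rules\<close>

text \<open>Variable \<open>3\<close> holds the index \<open>i\<close> of the current step, and variables \<open>4\<close>, \<open>5\<close>, \<open>6\<close> hold the vertices taken for \<open>u\<^sub>i\<close>, \<open>w\<^sub>i\<close>,
\<open>u\<^bsub>i+1\<^esub>\<close>. A rule consists of two conditions: the first says that neighbour \<open>0\<close> of \<open>u\<^bsub>i+1\<^esub>\<close> is \<open>u\<^bsub>i+2\<^esub>\<close>, the second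
that neighbour \<open>1\<close> is; otherwise it is neighbour \<open>2\<close>. A test that recognizes the spoke at \<open>u\<^bsub>i+1\<^esub>\<close> thus yields
a rule.\<close>

definition rimE :: "(exp \<Rightarrow> exp) \<Rightarrow> nat \<Rightarrow> exp" where
  "rimE tst d = andE (notE (eqE (nbE (Var 6) d) (Var 4))) (notE (tst (nbE (Var 6) d)))"

definition test_rule :: "(exp \<Rightarrow> exp) \<Rightarrow> exp \<times> exp" where
  "test_rule tst = (rimE tst 0, rimE tst 1)"

definition memberE :: "nat list \<Rightarrow> exp" where
  "memberE js = foldr (\<lambda>j. orE (eqE (Var 3) (Lit j))) js (Lit 0)"

text \<open>A constant of its own, so that rewriting never evaluates the list of its \<open>2 ^ 23\<close> sublists.\<close>

definition small_indices :: "nat list" where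
  "small_indices = [0..<23]"

text \<open>The rule of the four-paths, the rule for prisms, and the tables for \<open>n \<le> 22\<close>. A table consists of the
indices at which neighbour \<open>0\<close>, and of those at which neighbour \<open>1\<close>, is the right one.\<close>

definition rules :: "(exp \<times> exp) list" where
  "rules = test_rule (spoke_testE (Var 4) (Var 5) (Var 6)) # test_rule (adjE (Var 5)) #
     map (\<lambda>(J, K). (memberE J, memberE K)) (List.product (subseqs small_indices) (subseqs small_indices))"

lemma holds_memberE [simp]: "holds R m (memberE js) \<longleftrightarrow> R 3 \<in> set js"
  unfolding memberE_def by (induction js) (auto simp: holds_def[of _ _ "Lit 0"])

context cubic_input
begin

definition walk_state :: "(int \<Rightarrow> nat) \<Rightarrow> (int \<Rightarrow> nat) \<Rightarrow> nat \<Rightarrow> (nat \<Rightarrow> nat) \<Rightarrow> bool" where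
  "walk_state u w i R \<longleftrightarrow> R 3 = i \<and> R 4 = u (int i) \<and> R 5 = w (int i) \<and> R 6 = u (int i + 1)"

definition follows :: "exp \<times> exp \<Rightarrow> nat \<Rightarrow> (int \<Rightarrow> nat) \<Rightarrow> (int \<Rightarrow> nat) \<Rightarrow> bool" where
  "follows T n u w \<longleftrightarrow> (\<forall>i<n. \<forall>R m. graph_mem L m \<and> walk_state u w i R \<longrightarrow>
     L ! u (int i + 1) ! (if holds R m (fst T) then 0 else if holds R m (snd T) then 1 else 2) =
       u (int i + 2))"

lemma follows_test_rule:
  assumes "petersen_labelling (adj_of L) (length L) n k u w"
    and spoke: "\<And>R m e i. graph_mem L m \<Longrightarrow> walk_state u w i R \<Longrightarrow>
      val e R m = w (int i + 1) \<Longrightarrow> holds R m (tst e)"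
    and rim: "\<And>R m e i. graph_mem L m \<Longrightarrow> walk_state u w i R \<Longrightarrow>
      val e R m = u (int i + 2) \<Longrightarrow> \<not> holds R m (tst e)"
  shows "follows (test_rule tst) n u w"
  unfolding follows_def
proof (intro allI impI)
  interpret petersen_labelling "adj_of L" "length L" n k u w by fact
  fix i R m assume "i < n" and *: "graph_mem L m \<and> walk_state u w i R"
  define c where "c = u (int i + 1)"
  have R: "R 4 = u (int i)" "R 6 = c" using * by (auto simp: walk_state_def c_def)
  have c: "c < length L" using less by (simp add: c_def)
  have adj: "adj_of L c z \<longleftrightarrow> z = u (int i + 2) \<or> z = u (int i) \<or> z = w (int i + 1)" for z
    unfolding c_def adj_u by (simp add: algebra_simps)
  have "\<not> int n dvd 2" using n by (intro not_dvd) auto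
  then have neq: "u (int i + 2) \<noteq> u (int i)" by (simp add: u_eq)
  have iff: "holds R m (rimE tst d) \<longleftrightarrow> L ! c ! d = u (int i + 2)" if d: "d < 3" for d
  proof -
    have v: "val (nbE (Var 6) d) R m = L ! c ! d"
      using val_nbE_graph[of m "Var 6" R d] * d c by (simp add: R)
    have "L ! c ! d = u (int i + 2) \<or> L ! c ! d = u (int i) \<or> L ! c ! d = w (int i + 1)"
      using adj adj_nth[OF c d] by simp
    then show ?thesis
      using spoke[of m i R "nbE (Var 6) d"] rim[of m i R "nbE (Var 6) d"] * neq u_neq_w
      by (auto simp: rimE_def v R)
  qed
  have "\<exists>d<3. L ! c ! d = u (int i + 2)" using adj[of "u (int i + 2)"] adj_iff[OF c] by blast
  then show "L ! u (int i + 1) ! (if holds R m (fst (test_rule tst)) then 0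
      else if holds R m (snd (test_rule tst)) then 1 else 2) = u (int i + 2)"
    unfolding c_def[symmetric] test_rule_def less_3 using iff by auto
qed

lemma follows_table:
  assumes "petersen_labelling (adj_of L) (length L) n k u w"
    and "\<And>i. i < n \<Longrightarrow> i \<in> set J \<longleftrightarrow> L ! u (int i + 1) ! 0 = u (int i + 2)"
    and "\<And>i. i < n \<Longrightarrow> i \<in> set K \<longleftrightarrow> L ! u (int i + 1) ! 1 = u (int i + 2)"
  shows "follows (memberE J, memberE K) n u w"
proof -
  interpret petersen_labelling "adj_of L" "length L" n k u w by fact
  have "\<exists>d<3. L ! u (int i + 1) ! d = u (int i + 2)" for i
    using adj_u[of "int i + 1" "u (int i + 2)"] adj_iff[OF less(1)] by (simp add: algebra_simps)
  then show ?thesis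
    using assms(2,3) unfolding follows_def walk_state_def less_3 by auto
qed

text \<open>The prism rule covers \<open>k = 1\<close>, the tables cover \<open>n \<le> 22\<close>, and the rule of the four-paths covers the rest.\<close>

lemma rule_exists:
  assumes "petersen_labelling (adj_of L) (length L) n k u w"
  shows "\<exists>T\<in>set rules. follows T n u w"
proof -
  interpret petersen_labelling "adj_of L" "length L" n k u w by fact
  consider "k = 1" | "n \<le> 22" | "k \<noteq> 1" "22 < n" by linarith
  then show ?thesis
  proof cases
    case 1
    have "follows (test_rule (adjE (Var 5))) n u w"
      using prism_test[OF 1] less
      by (intro follows_test_rule[OF assms]) (auto simp: holds_adjE walk_state_def)
    then show ?thesis by (auto simp: rules_def)
  next
    case 2
    have sub: "\<exists>J\<in>set (subseqs small_indices). set J = {i. i < n \<and> P i}" for P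
    proof -
      have "{i. i < n \<and> P i} \<in> Pow (set small_indices)" using 2 by (auto simp: small_indices_def)
      then show ?thesis unfolding subseqs_powset[symmetric] by force
    qed
    obtain J K where J: "J \<in> set (subseqs small_indices)"
      "set J = {i. i < n \<and> L ! u (int i + 1) ! 0 = u (int i + 2)}"
      and K: "K \<in> set (subseqs small_indices)"
      "set K = {i. i < n \<and> L ! u (int i + 1) ! 1 = u (int i + 2)}"
      using sub by metis
    have "follows (memberE J, memberE K) n u w"
      using J K by (intro follows_table[OF assms]) auto
    moreover have "(memberE J, memberE K) \<in> set rules"
      using J(1) K(1) unfolding rules_def by auto
    ultimately show ?thesis by blast
  next
    case 3
    have "follows (test_rule (spoke_testE (Var 4) (Var 5) (Var 6))) n u w"
      using spoke_test_spoke[OF 3(1)] spoke_test_rim[OF 3] less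
      by (intro follows_test_rule[OF assms]) (auto simp: holds_spoke_testE walk_state_def)
    then show ?thesis by (auto simp: rules_def)
  qed
qed

end

section \<open>The program\<close>

text \<open>Besides the variables \<open>3\<close> to \<open>6\<close> used by the rules there are \<open>0\<close> for the answer, \<open>2\<close> for \<open>n\<close>, \<open>7\<close> for the next outer
vertex, \<open>8\<close> for \<open>k\<close>, \<open>9\<close> for a flag, and \<open>10\<close> for the number \<open>2 n\<close> of vertices.

The input ends at address \<open>8 n\<close>. Behind it, the first array has the vertex \<open>u\<^sub>j\<close> at index \<open>j\<close> and \<open>w\<^sub>j\<close> at index \<open>n + j\<close>. The
second array has at index \<open>v\<close> the index of \<open>v\<close> in the first. If the second array leads back from every
entry of the first, the entries are distinct, and this test needs no initialization of the arrays; so they can be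
reused for all guesses.\<close>

definition labelE :: "exp \<Rightarrow> exp" where
  "labelE j = Bin Add (Bin Add (Lit 1) (Bin Mul (Lit 4) (Var 10))) j"

definition indexE :: "exp \<Rightarrow> exp" where
  "indexE v = Bin Add (Bin Add (Lit 1) (Bin Mul (Lit 5) (Var 10))) v"

definition modE :: "exp \<Rightarrow> exp" where
  "modE e = Bin Sub e (Bin Mul (Var 2) (Bin Div e (Var 2)))"

lemma val_addr [simp]:
  "val (labelE j) R m = 1 + 4 * R 10 + val j R m"
  "val (indexE v) R m = 1 + 5 * R 10 + val v R m"
  "val (modE e) R m = val e R m mod R 2"
  by (auto simp: labelE_def indexE_def modE_def minus_mult_div_eq_mod)

definition increment :: cmd where
  "increment = Assign 3 (Bin Add (Var 3) (Lit 1))"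

definition record_labels :: cmd where
  "record_labels =
    Seq (Seq (Write (labelE (Var 3)) (Var 4)) (Write (labelE (Bin Add (Var 2) (Var 3))) (Var 5)))
      (Seq (Write (indexE (Var 4)) (Var 3)) (Write (indexE (Var 5)) (Bin Add (Var 2) (Var 3))))"

definition choose_rim :: "exp \<times> exp \<Rightarrow> cmd" where
  "choose_rim T = Cond (fst T) (Assign 7 (nbE (Var 6) 0))
    (Cond (snd T) (Assign 7 (nbE (Var 6) 1)) (Assign 7 (nbE (Var 6) 2)))"

text \<open>The neighbour of \<open>u\<^bsub>i+1\<^esub>\<close> that is neither \<open>u\<^sub>i\<close> nor the vertex just chosen for \<open>u\<^bsub>i+2\<^esub>\<close> is \<open>w\<^bsub>i+1\<^esub>\<close>.\<close>

definition otherE :: "nat \<Rightarrow> exp" where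
  "otherE d = andE (notE (eqE (nbE (Var 6) d) (Var 4))) (notE (eqE (nbE (Var 6) d) (Var 7)))"

definition choose_spoke :: cmd where
  "choose_spoke = Cond (otherE 0) (Assign 5 (nbE (Var 6) 0))
    (Cond (otherE 1) (Assign 5 (nbE (Var 6) 1)) (Assign 5 (nbE (Var 6) 2)))"

definition advance :: cmd where
  "advance = Seq (Assign 4 (Var 6)) (Seq (Assign 6 (Var 7)) increment)"

definition walk :: "exp \<times> exp \<Rightarrow> cmd" where
  "walk T = While (lessE (Var 3) (Var 2))
    (Seq record_labels (Seq (choose_rim T) (Seq choose_spoke advance)))"

definition checkE :: exp where
  "checkE =
    (let r = Cell (labelE (Var 3)); s = Cell (labelE (Bin Add (Var 2) (Var 3))) in
     andE (andE (lessE r (Var 10)) (lessE s (Var 10)))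
      (andE (andE (eqE (Cell (indexE r)) (Var 3)) (eqE (Cell (indexE s)) (Bin Add (Var 2) (Var 3))))
      (andE (adjE r (Cell (labelE (modE (Bin Add (Var 3) (Lit 1))))))
      (andE (adjE r s)
        (adjE s (Cell (labelE (Bin Add (Var 2) (modE (Bin Add (Var 3) (Var 8)))))))))))"

text \<open>The index of \<open>w\<^sub>k\<close>, taken to be neighbour \<open>d\<close> of \<open>w\<^sub>0\<close>, is \<open>n + k\<close>, which gives the value of \<open>k\<close> to be verified.\<close>

definition verify :: "nat \<Rightarrow> cmd" where
  "verify d =
    Seq (Seq (Assign 8 (Bin Sub (Cell (indexE (nbE (Cell (labelE (Var 2))) d))) (Var 2)))
      (Seq (Cond (andE (lessE (Lit 0) (Var 8)) (lessE (Bin Mul (Lit 2) (Var 8)) (Var 2)))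
             (Assign 9 (Lit 1)) (Assign 9 (Lit 0)))
        (Assign 3 (Lit 0))))
    (Seq (While (lessE (Var 3) (Var 2)) (Seq (Cond checkE Skip (Assign 9 (Lit 0))) increment))
      (Cond (Var 9) (Assign 0 (Lit 1)) Skip))"

text \<open>Start vertex, positions of \<open>w\<^sub>0\<close> and \<open>u\<^sub>1\<close> in its list of neighbours, rule, and position of \<open>w\<^sub>k\<close> in the list of \<open>w\<^sub>0\<close>.\<close>

type_synonym guess = "exp \<times> nat \<times> nat \<times> (exp \<times> exp) \<times> nat"

fun attempt :: "guess \<Rightarrow> cmd" where
  "attempt (s, ib, ic, T, d) =
    Seq (Seq (Assign 4 s) (Seq (Assign 5 (nbE (Var 4) ib)) (Seq (Assign 6 (nbE (Var 4) ic))
      (Assign 3 (Lit 0)))))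
    (Seq (walk T) (verify d))"

text \<open>Up to rotation, vertex \<open>0\<close> is \<open>u\<^sub>0\<close>, or it is \<open>w\<^sub>0\<close> and \<open>u\<^sub>0\<close> is one of its neighbours.\<close>

definition starts :: "exp list" where
  "starts = [Lit 0, nbE (Lit 0) 0, nbE (Lit 0) 1, nbE (Lit 0) 2]"

definition guesses :: "guess list" where
  "guesses = List.product starts (List.product [0, 1, 2] (List.product [0, 1, 2]
     (List.product rules [0, 1, 2])))"

text \<open>The degree of vertex \<open>i\<close> is at address \<open>1 + 4 i\<close> provided that all earlier vertices have degree three. The first
loop is right all the same: the first deviating degree is found at the proper place, and what is read
behind it can no longer matter.\<close>

definition recognizer :: cmd where
  "recognizer =
    Seq (Seq (Assign 10 (Cell (Lit 0))) (Seq (Assign 2 (Bin Div (Var 10) (Lit 2)))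
      (Seq (Cond (andE (eqE (Var 10) (Bin Mul (Lit 2) (Var 2))) (lessE (Lit 2) (Var 2)))
             (Assign 9 (Lit 1)) (Assign 9 (Lit 0)))
        (Assign 3 (Lit 0)))))
    (Seq (While (lessE (Var 3) (Var 10))
           (Seq (Cond (eqE (Cell (Bin Add (Lit 1) (Bin Mul (Lit 4) (Var 3)))) (Lit 3))
                  Skip (Assign 9 (Lit 0)))
             increment))
      (Cond (Var 9) (foldr (\<lambda>g. Seq (attempt g)) guesses Skip) Skip))"

lemma unnested_recognizer: "unnested recognizer"
proof -
  have "unnested (attempt g)" for g
    by (cases g) (simp add: walk_def verify_def record_labels_def choose_rim_def
      choose_spoke_def advance_def increment_def)
  then have "unnested (foldr (\<lambda>g. Seq (attempt g)) gs Skip)" for gs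
    by (induction gs) auto
  then show ?thesis by (simp add: recognizer_def increment_def)
qed

definition petersen_input :: "nat list list \<Rightarrow> bool" where
  "petersen_input L \<longleftrightarrow> (\<exists>n k \<phi>. 3 \<le> n \<and> 1 \<le> k \<and> 2 * k < n \<and>
     gp_embedding (adj_of L) (length L) n k \<phi>)"

lemma holds_Var [simp]: "holds R m (Var x) \<longleftrightarrow> R x \<noteq> 0"
  by (simp add: holds_def)

section \<open>Correctness of the program\<close>

locale even_cubic_input = cubic_input +
  fixes n :: nat
  assumes length_L: "length L = 2 * n" and n: "3 \<le> n"
begin

definition base :: "(nat \<Rightarrow> nat) \<Rightarrow> (nat \<Rightarrow> nat) \<Rightarrow> bool" where
  "base R m \<longleftrightarrow> R 10 = length L \<and> R 2 = n \<and> graph_mem L m"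

definition label :: "(nat \<Rightarrow> nat) \<Rightarrow> nat \<Rightarrow> nat" where
  "label m j = m (1 + 4 * length L + j)"

definition index :: "(nat \<Rightarrow> nat) \<Rightarrow> nat \<Rightarrow> nat" where
  "index m v = m (1 + 5 * length L + v)"

definition filled :: "(int \<Rightarrow> nat) \<Rightarrow> (int \<Rightarrow> nat) \<Rightarrow> nat \<Rightarrow> (nat \<Rightarrow> nat) \<Rightarrow> bool" where
  "filled u w j m \<longleftrightarrow> (\<forall>i<j. label m i = u (int i) \<and> label m (n + i) = w (int i) \<and>
     index m (u (int i)) = i \<and> index m (w (int i)) = n + i)"

definition labelling :: "nat \<Rightarrow> (int \<Rightarrow> nat) \<Rightarrow> (int \<Rightarrow> nat) \<Rightarrow> bool" where
  "labelling k u w \<longleftrightarrow> petersen_labelling (adj_of L) (length L) n k u w"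

abbreviation "M \<equiv> length L + 2"
abbreviation "ok_here \<equiv> ok M (length L)"

text \<open>Here and in the following lemmas, the walk is described for all labellings at once by an implication: it must run
within its bounds and leave the input intact for wrong guesses too.\<close>

lemma ok_record_labels:
  assumes b: "bounded_state M R m" and base: "base R m" and j: "R 3 = j" "j < n"
  shows "ok_here record_labels R m (\<lambda>R' m'. R' = R \<and> graph_mem L m' \<and>
    (\<forall>k u w. labelling k u w \<and> walk_state u w j R \<and> filled u w j m \<longrightarrow> filled u w (Suc j) m'))"
proof -
  let ?N = "length L"
  define m' where "m' = m(1 + 4 * ?N + j := R 4, 1 + 4 * ?N + (n + j) := R 5,
    1 + 5 * ?N + R 4 := j, 1 + 5 * ?N + R 5 := n + j)"
  have R: "R 10 = ?N" "R 2 = n" using base by (auto simp: base_def)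
  have graph: "graph_mem L m'"
    using base unfolding base_def graph_mem_def m'_def by auto
  have fill: "filled u w (Suc j) m'"
    if "labelling k u w" "walk_state u w j R" and f: "filled u w j m" for k u w
    unfolding filled_def
  proof (intro allI impI)
    interpret petersen_labelling "adj_of L" ?N n k u w using that(1) by (simp add: labelling_def)
    have R': "R 4 = u (int j)" "R 5 = w (int j)" using that(2) by (auto simp: walk_state_def)
    fix i assume i: "i < Suc j"
    have nw: "w a \<noteq> u b" for a b using u_neq_w[of b a] by simp
    show "label m' i = u (int i) \<and> label m' (n + i) = w (int i) \<and>
     index m' (u (int i)) = i \<and> index m' (w (int i)) = n + i"
    proof (cases "i = j")
      case True
      then show ?thesis
        using j(2) length_L u_neq_w nw by (simp add: label_def index_def m'_def R')
    next
      case False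
      then have "\<not> int n dvd int i - int j" using i j(2) by (intro not_dvd) auto
      then have "u (int i) \<noteq> u (int j)" "w (int i) \<noteq> w (int j)" by (auto simp: u_eq w_eq)
      moreover have "i < j" using i False by simp
      ultimately show ?thesis
        using f j(2) length_L u_neq_w nw by (simp add: label_def index_def m'_def R' filled_def)
    qed
  qed
  have "R 4 \<le> M" "R 5 \<le> M" using b by (auto simp: bounded_state_def)
  then have "wp M record_labels (\<lambda>R' m''. R' = R \<and> m'' = m') R m"
    using j length_L by (simp add: record_labels_def R m'_def)
  from wp_ok[OF b this] show ?thesis
    by (rule ok_mono[OF _ b]) (use graph fill in blast)
qed

lemma ok_choose_rim:
  assumes b: "bounded_state M R m" and base: "base R m" and j: "j < n"
  shows "ok_here (choose_rim T) R m (\<lambda>R' m'. m' = m \<and> (\<exists>z. R' = R(7 := z) \<and>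
    (\<forall>k u w. labelling k u w \<and> walk_state u w j R \<and> follows T n u w \<longrightarrow> z = u (int j + 2))))"
proof -
  define d where "d = (if holds R m (fst T) then 0 else if holds R m (snd T) then 1 else 2 :: nat)"
  have d: "d < 3" by (simp add: d_def)
  let ?z = "val (nbE (Var 6) d) R m"
  have *: "?z = u (int j + 2)"
    if "labelling k u w" "walk_state u w j R" "follows T n u w" for k u w
  proof -
    interpret petersen_labelling "adj_of L" "length L" n k u w using that(1) by (simp add: labelling_def)
    have "R 6 = u (int j + 1)" using that by (simp add: walk_state_def)
    then have "?z = L ! u (int j + 1) ! d"
      using val_nbE_graph[of m "Var 6" R d] base less d by (simp add: base_def)
    also have "\<dots> = u (int j + 2)"
      using that base j unfolding follows_def base_def d_def by blast
    finally show ?thesis .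
  qed
  have "val (nbE (Var 6) d) R m \<le> M" for d using b by (simp add: bounded_state_def val_nbE)
  then show ?thesis
    using * by (intro wp_ok[OF b]) (auto simp: choose_rim_def d_def)
qed

lemma ok_choose_spoke:
  assumes b: "bounded_state M R m" and base: "base R m"
  shows "ok_here choose_spoke R m (\<lambda>R' m'. m' = m \<and> (\<exists>z. R' = R(5 := z) \<and>
    (\<forall>k u w. labelling k u w \<and> walk_state u w j R \<and> R 7 = u (int j + 2) \<longrightarrow> z = w (int j + 1))))"
proof -
  define d where "d = (if holds R m (otherE 0) then 0 else if holds R m (otherE 1) then 1 else 2 :: nat)"
  let ?z = "val (nbE (Var 6) d) R m"
  have *: "?z = w (int j + 1)"
    if "labelling k u w" and ws: "walk_state u w j R" and R7: "R 7 = u (int j + 2)" for k u w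
  proof -
    interpret petersen_labelling "adj_of L" "length L" n k u w using that(1) by (simp add: labelling_def)
    define c where "c = u (int j + 1)"
    have R: "R 6 = c" "R 4 = u (int j)" using ws by (auto simp: walk_state_def c_def)
    have c: "c < length L" using less by (simp add: c_def)
    have v: "val (nbE (Var 6) d) R m = L ! c ! d" if "d < 3" for d
      using val_nbE_graph[of m "Var 6" R d] base c that by (simp add: base_def R)
    have adj: "adj_of L c z \<longleftrightarrow> z = u (int j + 2) \<or> z = u (int j) \<or> z = w (int j + 1)" for z
      unfolding c_def adj_u by (simp add: algebra_simps)
    have iff: "holds R m (otherE d) \<longleftrightarrow> L ! c ! d = w (int j + 1)" if "d < 3" for d
    proof -
      have nw: "w a \<noteq> u b" for a b using u_neq_w[of b a] by simp
      have "L ! c ! d = u (int j + 2) \<or> L ! c ! d = u (int j) \<or> L ! c ! d = w (int j + 1)"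
        using adj adj_nth[OF c that] by simp
      then show ?thesis using nw u_neq_w by (auto simp: otherE_def v[OF that] R R7)
    qed
    have "\<exists>d<3. L ! c ! d = w (int j + 1)" using adj[of "w (int j + 1)"] adj_iff[OF c] by blast
    then show ?thesis unfolding less_3 by (auto simp: d_def v iff)
  qed
  have "val (nbE (Var 6) d) R m \<le> M" for d using b by (simp add: bounded_state_def val_nbE)
  then show ?thesis
    using * by (intro wp_ok[OF b]) (auto simp: choose_spoke_def d_def)
qed

lemma ok_walk:
  assumes b: "bounded_state M R m" and base: "base R m" and R3: "R 3 = 0"
  shows "ok_here (walk T) R m (\<lambda>R' m'. base R' m' \<and> R' 0 = R 0 \<and>
    (\<forall>k u w. labelling k u w \<and> walk_state u w 0 R \<and> follows T n u w \<longrightarrow> filled u w n m'))"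
proof -
  define I where "I j R' m' \<longleftrightarrow> base R' m' \<and> R' 0 = R 0 \<and> R' 3 = j \<and>
    (\<forall>k u w. labelling k u w \<and> walk_state u w 0 R \<and> follows T n u w \<longrightarrow>
       walk_state u w j R' \<and> filled u w j m')" for j R' m'
  have "ok_here (walk T) R m (I n)"
    unfolding walk_def
  proof (rule ok_While[OF b])
    show "I 0 R m" using base R3 by (auto simp: I_def filled_def)
    show "n \<le> length L" using length_L by simp
    show "\<not> holds R' m' (lessE (Var 3) (Var 2))" if "I n R' m'" for R' m'
      using that by (simp add: I_def base_def)
    fix j R1 m1 assume j: "j < n" and I: "I j R1 m1" and b1: "bounded_state M R1 m1"
    have base1: "base R1 m1" and R1: "R1 3 = j" "R1 0 = R 0" using I by (auto simp: I_def)
    have "ok_here (Seq record_labels (Seq (choose_rim T) (Seq choose_spoke advance))) R1 m1 (I (Suc j))"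
    proof (rule ok_Seq[OF ok_record_labels[OF b1 base1 R1(1) j] b1])
      fix R2 m2
      assume 2: "R2 = R1 \<and> graph_mem L m2 \<and> (\<forall>k u w. labelling k u w \<and> walk_state u w j R1 \<and>
        filled u w j m1 \<longrightarrow> filled u w (Suc j) m2)" and b2: "bounded_state M R2 m2"
      have base2: "base R2 m2" using 2 base1 by (simp add: base_def)
      show "ok_here (Seq (choose_rim T) (Seq choose_spoke advance)) R2 m2 (I (Suc j))"
      proof (rule ok_Seq[OF ok_choose_rim[OF b2 base2 j] b2])
        fix R3 m3
        assume 3: "m3 = m2 \<and> (\<exists>z. R3 = R2(7 := z) \<and> (\<forall>k u w. labelling k u w \<and>
          walk_state u w j R2 \<and> follows T n u w \<longrightarrow> z = u (int j + 2)))"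
          and b3: "bounded_state M R3 m3"
        have base3: "base R3 m3" using 3 base2 by (auto simp: base_def)
        show "ok_here (Seq choose_spoke advance) R3 m3 (I (Suc j))"
        proof (rule ok_Seq[OF ok_choose_spoke[OF b3 base3] b3])
          fix R4 m4
          assume 4: "m4 = m3 \<and> (\<exists>z. R4 = R3(5 := z) \<and> (\<forall>k u w. labelling k u w \<and>
            walk_state u w j R3 \<and> R3 7 = u (int j + 2) \<longrightarrow> z = w (int j + 1)))"
            and b4: "bounded_state M R4 m4"
          obtain z where z: "R3 = R1(7 := z)" "\<And>k u w. labelling k u w \<Longrightarrow>
            walk_state u w j R1 \<Longrightarrow> follows T n u w \<Longrightarrow> z = u (int j + 2)" using 2 3 by blast
          obtain y where y: "R4 = R3(5 := y)" "\<And>k u w. labelling k u w \<Longrightarrow>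
            walk_state u w j R3 \<Longrightarrow> R3 7 = u (int j + 2) \<Longrightarrow> y = w (int j + 1)" using 4 by blast
          have ws: "walk_state u w j R3 \<longleftrightarrow> walk_state u w j R1" for u w
            by (simp add: z(1) walk_state_def)
          have "I (Suc j) (R4(4 := R4 6, 6 := R4 7, 3 := R4 3 + 1)) m4"
            unfolding I_def
          proof (intro conjI allI impI; (elim conjE)?)
            show "base (R4(4 := R4 6, 6 := R4 7, 3 := R4 3 + 1)) m4"
              using base2 2 3 4 by (simp add: base_def y z)
            show "(R4(4 := R4 6, 6 := R4 7, 3 := R4 3 + 1)) 0 = R 0"
              "(R4(4 := R4 6, 6 := R4 7, 3 := R4 3 + 1)) 3 = Suc j"
              by (simp_all add: y z R1)
            fix k u w assume *: "labelling k u w" "walk_state u w 0 R" "follows T n u w"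
            then have w1: "walk_state u w j R1" and f1: "filled u w j m1" using I by (auto simp: I_def)
            show "filled u w (Suc j) m4" using 2 3 4 *(1) w1 f1 by blast
            have zz: "z = u (int j + 2)" using z(2) * w1 by blast
            then have "y = w (int j + 1)" using y(2)[OF *(1)] w1 ws by (simp add: z(1))
            then show "walk_state u w (Suc j) (R4(4 := R4 6, 6 := R4 7, 3 := R4 3 + 1))"
              using w1 zz by (simp add: walk_state_def y(1) z(1) algebra_simps)
          qed
          moreover have "R4 6 \<le> M" "R4 7 \<le> M" using b4 by (auto simp: bounded_state_def)
          moreover have "R4 3 = j" using R1 by (simp add: y(1) z(1))
          ultimately show "ok_here advance R4 m4 (I (Suc j))"
            using j length_L by (intro wp_ok[OF b4]) (simp add: advance_def increment_def)
        qed
      qed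
    qed
    then show "holds R1 m1 (lessE (Var 3) (Var 2)) \<and>
        ok_here (Seq record_labels (Seq (choose_rim T) (Seq choose_spoke advance))) R1 m1 (I (Suc j))"
      using I j by (simp add: I_def base_def)
  qed
  then show ?thesis by (rule ok_mono[OF _ b]) (auto simp: I_def)
qed

definition check :: "(nat \<Rightarrow> nat) \<Rightarrow> nat \<Rightarrow> nat \<Rightarrow> bool" where
  "check m k i \<longleftrightarrow> (label m i < length L \<and> label m (n + i) < length L) \<and>
     (index m (label m i) = i \<and> index m (label m (n + i)) = n + i) \<and>
     adj_of L (label m i) (label m ((i + 1) mod n)) \<and>
     adj_of L (label m i) (label m (n + i)) \<and>
     adj_of L (label m (n + i)) (label m (n + (i + k) mod n))"

lemma holds_checkE:
  assumes "base R m"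
  shows "holds R m checkE \<longleftrightarrow> check m (R 8) (R 3)"
proof -
  have "R 10 = length L" "R 2 = n" "graph_mem L m" using assms by (auto simp: base_def)
  then show ?thesis
    unfolding checkE_def Let_def check_def label_def index_def
    by (simp add: holds_adjE cong: conj_cong)
qed

text \<open>The second array makes the labels distinct, so they exhaust the \<open>2 n\<close> vertices; the edges found by the check are
then all edges, since the graph is cubic.\<close>

lemma check_sound:
  assumes k: "1 \<le> k" "2 * k < n" and check: "\<And>i. i < n \<Longrightarrow> check m k i"
  shows "petersen_input L"
proof -
  define \<phi> where "\<phi> x = (case x of U i \<Rightarrow> label m i | W i \<Rightarrow> label m (n + i))" for x
  have idx: "index m (\<phi> x) = (case x of U i \<Rightarrow> i | W i \<Rightarrow> n + i)" if "x \<in> gp_verts n" for x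
    using that check by (auto simp: gp_verts_def \<phi>_def check_def)
  have "inj_on \<phi> (gp_verts n)"
  proof (rule inj_onI)
    fix x y assume "x \<in> gp_verts n" "y \<in> gp_verts n" "\<phi> x = \<phi> y"
    then have "(case x of U i \<Rightarrow> i | W i \<Rightarrow> n + i) = (case y of U i \<Rightarrow> i | W i \<Rightarrow> n + i)"
      using idx[of x] idx[of y] by metis
    then show "x = y"
      using \<open>x \<in> gp_verts n\<close> \<open>y \<in> gp_verts n\<close> by (cases x; cases y) (auto simp: gp_verts_def)
  qed
  moreover have "card (gp_verts n) = 2 * n"
    unfolding gp_verts_def by (subst card_Un_disjoint) (auto simp: card_image inj_on_def)
  moreover have "\<phi> ` gp_verts n \<subseteq> {..<length L}"
    using check by (auto simp: gp_verts_def \<phi>_def check_def)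
  ultimately have bij: "bij_betw \<phi> (gp_verts n) {..<length L}"
    unfolding bij_betw_def using length_L by (metis card_image card_lessThan card_subset_eq finite_lessThan)
  have deg3: "finite {z. adj_of L v z} \<and> card {z. adj_of L v z} \<le> 3" if "v < length L" for v
    using that deg[OF that] card_length[of "L ! v"] by (simp add: adj_of_def)
  have "gp_embedding (adj_of L) (length L) n k \<phi>"
    by (rule gp_embedding_if_edges[OF n k bij deg3 sym]) (use check in \<open>auto simp: \<phi>_def check_def\<close>)
  then show ?thesis unfolding petersen_input_def using n k by blast
qed

lemma check_complete:
  assumes "labelling k u w" "filled u w n m" "i < n"
  shows "check m k i"
proof -
  interpret petersen_labelling "adj_of L" "length L" n k u w using assms(1) by (simp add: labelling_def)
  have f: "label m i = u (int i)" "label m (n + i) = w (int i)" "index m (u (int i)) = i"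
    "index m (w (int i)) = n + i" if "i < n" for i
    using assms(2) that by (auto simp: filled_def)
  have mod: "int n dvd int (j mod n) - int j" for j
    by (simp add: zmod_int flip: mod_eq_dvd_iff)
  have "u (int ((i + 1) mod n)) = u (int i + 1)" "w (int ((i + k) mod n)) = w (int i + int k)"
    using mod[of "i + 1"] mod[of "i + k"] by (simp_all add: u_eq w_eq add.commute)
  moreover have "(i + 1) mod n < n" "(i + k) mod n < n" using n by auto
  ultimately show ?thesis
    using assms(3) less unfolding check_def by (simp add: f adj_u adj_w)
qed

lemma ok_verify:
  assumes b: "bounded_state M R m" and base: "base R m" and d: "d < 3"
  shows "ok_here (verify d) R m (\<lambda>R' m'. base R' m' \<and>
    (R' 0 = R 0 \<or> R' 0 = 1 \<and> petersen_input L) \<and>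
    ((\<exists>k u w. labelling k u w \<and> filled u w n m \<and> L ! w 0 ! d = w (int k)) \<longrightarrow> R' 0 = 1))"
proof -
  define k where "k = index m (m (2 + d + 4 * label m n)) - n"
  have R: "R 10 = length L" "R 2 = n" using base by (auto simp: base_def)
  have k_eq: "k' = k" if "labelling k' u w" "filled u w n m" "L ! w 0 ! d = w (int k')" for k' u w
  proof -
    interpret petersen_labelling "adj_of L" "length L" n k' u w using that(1) by (simp add: labelling_def)
    have f: "label m (n + i) = w (int i)" "index m (w (int i)) = n + i" if "i < n" for i
      using \<open>filled u w n m\<close> that by (auto simp: filled_def)
    have "label m n = w 0" using f(1)[of 0] n by simp
    moreover have "m (2 + d + 4 * w 0) = w (int k')"
      using base d less that(3) by (auto simp: base_def graph_mem_def)
    moreover have "index m (w (int k')) = n + k'" using k by (intro f(2)) simp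
    ultimately show ?thesis using that(3) by (simp add: k_def)
  qed
  define flag where "flag = (if 0 < k \<and> 2 * k < n then 1 else 0 :: nat)"
  define R1 where "R1 = R(8 := k, 9 := flag, 3 := 0)"
  have kM: "k \<le> M"
    using b unfolding k_def index_def bounded_state_def by (meson diff_le_self le_trans)
  have 1: "ok_here (Seq (Assign 8 (Bin Sub (Cell (indexE (nbE (Cell (labelE (Var 2))) d))) (Var 2)))
      (Seq (Cond (andE (lessE (Lit 0) (Var 8)) (lessE (Bin Mul (Lit 2) (Var 8)) (Var 2)))
             (Assign 9 (Lit 1)) (Assign 9 (Lit 0)))
        (Assign 3 (Lit 0)))) R m (\<lambda>R' m'. R' = R1 \<and> m' = m)"
  proof (rule wp_ok[OF b])
    have "val (Bin Sub (Cell (indexE (nbE (Cell (labelE (Var 2))) d))) (Var 2)) R m = k"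
      by (simp add: R k_def index_def label_def val_nbE)
    then show "wp M (Seq (Assign 8 (Bin Sub (Cell (indexE (nbE (Cell (labelE (Var 2))) d))) (Var 2)))
      (Seq (Cond (andE (lessE (Lit 0) (Var 8)) (lessE (Bin Mul (Lit 2) (Var 8)) (Var 2)))
             (Assign 9 (Lit 1)) (Assign 9 (Lit 0)))
        (Assign 3 (Lit 0)))) (\<lambda>R' m'. R' = R1 \<and> m' = m) R m"
      unfolding wp.simps using kM by (simp add: R R1_def flag_def)
  qed
  define I where "I j R' m' \<longleftrightarrow> m' = m \<and> base R' m \<and> R' 0 = R 0 \<and> R' 3 = j \<and> R' 8 = k \<and>
    (R' 9 \<noteq> 0 \<longleftrightarrow> (1 \<le> k \<and> 2 * k < n) \<and> (\<forall>i<j. check m k i))" for j R' m'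
  have 2: "ok_here (While (lessE (Var 3) (Var 2)) (Seq (Cond checkE Skip (Assign 9 (Lit 0))) increment))
    R1 m (I n)" if b1: "bounded_state M R1 m"
  proof (rule ok_While[OF b1])
    show "I 0 R1 m" using base by (auto simp: I_def R1_def flag_def base_def)
    show "n \<le> length L" using length_L by simp
    show "\<not> holds R' m' (lessE (Var 3) (Var 2))" if "I n R' m'" for R' m'
      using that by (simp add: I_def base_def)
    fix j R' m' assume j: "j < n" and I: "I j R' m'" and b': "bounded_state M R' m'"
    have h: "holds R' m checkE \<longleftrightarrow> check m k j" using holds_checkE[of R' m] I by (simp add: I_def)
    have "ok_here (Seq (Cond checkE Skip (Assign 9 (Lit 0))) increment) R' m' (I (Suc j))"
      using I j length_L
      by (intro wp_ok[OF b'], cases "check m k j")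
        (simp_all add: h increment_def I_def base_def All_less_Suc)
    then show "holds R' m' (lessE (Var 3) (Var 2)) \<and>
        ok_here (Seq (Cond checkE Skip (Assign 9 (Lit 0))) increment) R' m' (I (Suc j))"
      using I j by (simp add: I_def base_def)
  qed
  show ?thesis
    unfolding verify_def
  proof (rule ok_Seq[OF 1 b], elim conjE, hypsubst)
    assume b1: "bounded_state M R1 m"
    show "ok_here (Seq (While (lessE (Var 3) (Var 2)) (Seq (Cond checkE Skip (Assign 9 (Lit 0))) increment))
      (Cond (Var 9) (Assign 0 (Lit 1)) Skip)) R1 m (\<lambda>R' m'. base R' m' \<and>
    (R' 0 = R 0 \<or> R' 0 = 1 \<and> petersen_input L) \<and>
    ((\<exists>k u w. labelling k u w \<and> filled u w n m \<and> L ! w 0 ! d = w (int k)) \<longrightarrow> R' 0 = 1))"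
    proof (rule ok_Seq[OF 2[OF b1] b1])
      fix R' m' assume I: "I n R' m'" and b': "bounded_state M R' m'"
      have sound: "petersen_input L" if "R' 9 \<noteq> 0"
        using that I check_sound[of k m] by (simp add: I_def)
      have complete: "R' 9 \<noteq> 0" if "labelling k' u w" "filled u w n m" "L ! w 0 ! d = w (int k')" for k' u w
      proof -
        interpret petersen_labelling "adj_of L" "length L" n k' u w
          using that(1) by (simp add: labelling_def)
        show ?thesis
          using k_eq[OF that] check_complete[OF that(1,2)] k I by (simp add: I_def)
      qed
      show "ok_here (Cond (Var 9) (Assign 0 (Lit 1)) Skip) R' m' (\<lambda>R' m'. base R' m' \<and>
        (R' 0 = R 0 \<or> R' 0 = 1 \<and> petersen_input L) \<and>
        ((\<exists>k u w. labelling k u w \<and> filled u w n m \<and> L ! w 0 ! d = w (int k)) \<longrightarrow> R' 0 = 1))"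
        using I sound complete by (intro wp_ok[OF b']) (auto simp: I_def base_def)
    qed
  qed
qed

end

context even_cubic_input
begin

fun suits :: "guess \<Rightarrow> nat \<Rightarrow> (int \<Rightarrow> nat) \<Rightarrow> (int \<Rightarrow> nat) \<Rightarrow> bool" where
  "suits (s, ib, ic, T, d) k u w \<longleftrightarrow> labelling k u w \<and>
     (\<forall>R m. base R m \<longrightarrow> val s R m = u 0) \<and> ib < 3 \<and> L ! u 0 ! ib = w 0 \<and>
     ic < 3 \<and> L ! u 0 ! ic = u 1 \<and> follows T n u w \<and> L ! w 0 ! d = w (int k)"

lemma ok_attempt:
  assumes b: "bounded_state M R m" and base: "base R m" and g: "g \<in> set guesses"
  shows "ok_here (attempt g) R m (\<lambda>R' m'. base R' m' \<and>
    (R' 0 = R 0 \<or> R' 0 = 1 \<and> petersen_input L) \<and> ((\<exists>k u w. suits g k u w) \<longrightarrow> R' 0 = 1))"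
proof -
  obtain s ib ic T d where g_eq: "g = (s, ib, ic, T, d)" by (cases g)
  have s: "s \<in> set starts" and d: "d < 3" using g by (auto simp: g_eq guesses_def)
  define R1 where "R1 = (let a = val s R m in
    R(4 := a, 5 := m (2 + ib + 4 * a), 6 := m (2 + ic + 4 * a), 3 := 0))"
  have "val s R m \<le> M" using s b by (auto simp: starts_def val_nbE bounded_state_def)
  then have 1: "ok_here (Seq (Assign 4 s) (Seq (Assign 5 (nbE (Var 4) ib)) (Seq (Assign 6 (nbE (Var 4) ic))
      (Assign 3 (Lit 0))))) R m (\<lambda>R' m'. R' = R1 \<and> m' = m)"
    using b by (intro wp_ok[OF b]) (simp add: R1_def Let_def val_nbE bounded_state_def)
  have base1: "base R1 m" using base by (simp add: base_def R1_def Let_def)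
  have R1: "R1 0 = R 0" "R1 3 = 0" by (auto simp: R1_def Let_def)
  have ws: "walk_state u w 0 R1" if "suits g k u w" for k u w
  proof -
    interpret petersen_labelling "adj_of L" "length L" n k u w using that by (simp add: g_eq labelling_def)
    have "val s R m = u 0" using that base by (simp add: g_eq)
    moreover have "m (2 + e + 4 * u 0) = L ! u 0 ! e" if "e < 3" for e
      using base that less unfolding base_def graph_mem_def by blast
    ultimately show ?thesis using that by (simp add: g_eq R1_def walk_state_def Let_def)
  qed
  show ?thesis
    unfolding g_eq attempt.simps
  proof (rule ok_Seq[OF 1 b], elim conjE, hypsubst)
    assume b1: "bounded_state M R1 m"
    show "ok_here (Seq (walk T) (verify d)) R1 m (\<lambda>R' m'. base R' m' \<and>
      (R' 0 = R 0 \<or> R' 0 = 1 \<and> petersen_input L) \<and>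
      ((\<exists>k u w. suits (s, ib, ic, T, d) k u w) \<longrightarrow> R' 0 = 1))"
    proof (rule ok_Seq[OF ok_walk[OF b1 base1 R1(2)] b1])
      fix R2 m2
      assume 2: "base R2 m2 \<and> R2 0 = R1 0 \<and> (\<forall>k u w. labelling k u w \<and> walk_state u w 0 R1 \<and>
        follows T n u w \<longrightarrow> filled u w n m2)" and b2: "bounded_state M R2 m2"
      have base2: "base R2 m2" using 2 by simp
      show "ok_here (verify d) R2 m2 (\<lambda>R' m'. base R' m' \<and>
        (R' 0 = R 0 \<or> R' 0 = 1 \<and> petersen_input L) \<and>
        ((\<exists>k u w. suits (s, ib, ic, T, d) k u w) \<longrightarrow> R' 0 = 1))"
      proof (rule ok_mono[OF ok_verify[OF b2 base2 d] b2], intro conjI impI)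
        fix R' m'
        assume 3: "base R' m' \<and> (R' 0 = R2 0 \<or> R' 0 = 1 \<and> petersen_input L) \<and>
          ((\<exists>k u w. labelling k u w \<and> filled u w n m2 \<and> L ! w 0 ! d = w (int k)) \<longrightarrow> R' 0 = 1)"
        show "base R' m'" "R' 0 = R 0 \<or> R' 0 = 1 \<and> petersen_input L"
          using 2 3 R1 by auto
        show "R' 0 = 1" if "\<exists>k u w. suits (s, ib, ic, T, d) k u w"
        proof -
          from that obtain k u w where suits: "suits (s, ib, ic, T, d) k u w" by blast
          have "filled u w n m2" using 2 suits ws[of k u w] by (simp add: g_eq) blast
          then show ?thesis using 3 suits by auto
        qed
      qed
    qed
  qed
qed

lemma ok_attempts:
  assumes "bounded_state M R m" "base R m" "set gs \<subseteq> set guesses"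
    and "R 0 = 0 \<or> R 0 = 1 \<and> petersen_input L"
  shows "ok_here (foldr (\<lambda>g. Seq (attempt g)) gs Skip) R m (\<lambda>R' m'.
    (R' 0 = 0 \<or> R' 0 = 1 \<and> petersen_input L) \<and>
    (R 0 = 1 \<or> (\<exists>g\<in>set gs. \<exists>k u w. suits g k u w) \<longrightarrow> R' 0 = 1))"
  using assms
proof (induction gs arbitrary: R m)
  case Nil
  then show ?case by (intro wp_ok) auto
next
  case (Cons g gs)
  have g: "g \<in> set guesses" "set gs \<subseteq> set guesses" using Cons.prems by auto
  have "ok_here (Seq (attempt g) (foldr (\<lambda>g. Seq (attempt g)) gs Skip)) R m (\<lambda>R' m'.
    (R' 0 = 0 \<or> R' 0 = 1 \<and> petersen_input L) \<and>
    (R 0 = 1 \<or> (\<exists>g\<in>set (g # gs). \<exists>k u w. suits g k u w) \<longrightarrow> R' 0 = 1))"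
  proof (rule ok_Seq[OF ok_attempt[OF Cons.prems(1,2) g(1)] Cons.prems(1)])
    fix R1 m1
    assume 1: "base R1 m1 \<and> (R1 0 = R 0 \<or> R1 0 = 1 \<and> petersen_input L) \<and>
      ((\<exists>k u w. suits g k u w) \<longrightarrow> R1 0 = 1)" and b1: "bounded_state M R1 m1"
    have "R1 0 = 0 \<or> R1 0 = 1 \<and> petersen_input L" using 1 Cons.prems(4) by auto
    with 1 have ih: "ok_here (foldr (\<lambda>g. Seq (attempt g)) gs Skip) R1 m1 (\<lambda>R' m'.
      (R' 0 = 0 \<or> R' 0 = 1 \<and> petersen_input L) \<and>
      (R1 0 = 1 \<or> (\<exists>g\<in>set gs. \<exists>k u w. suits g k u w) \<longrightarrow> R' 0 = 1))"
      by (intro Cons.IH b1 g(2)) simp_all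
    show "ok_here (foldr (\<lambda>g. Seq (attempt g)) gs Skip) R1 m1 (\<lambda>R' m'.
      (R' 0 = 0 \<or> R' 0 = 1 \<and> petersen_input L) \<and>
      (R 0 = 1 \<or> (\<exists>g\<in>set (g # gs). \<exists>k u w. suits g k u w) \<longrightarrow> R' 0 = 1))"
    proof (rule ok_mono[OF ih b1])
      fix R' m'
      assume h: "(R' 0 = 0 \<or> R' 0 = 1 \<and> petersen_input L) \<and>
        (R1 0 = 1 \<or> (\<exists>g\<in>set gs. \<exists>k u w. suits g k u w) \<longrightarrow> R' 0 = 1)"
      have "R 0 = 1 \<or> (\<exists>k u w. suits g k u w) \<longrightarrow> R1 0 = 1" using 1 by metis
      with h show "(R' 0 = 0 \<or> R' 0 = 1 \<and> petersen_input L) \<and>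
        (R 0 = 1 \<or> (\<exists>g\<in>set (g # gs). \<exists>k u w. suits g k u w) \<longrightarrow> R' 0 = 1)"
        unfolding list.set bex_simps by blast
    qed
  qed
  then show ?case by (simp only: foldr.simps o_apply)
qed

text \<open>Rotating a given labelling brings vertex \<open>0\<close> to index \<open>0\<close>; the other components of the guess are then read
off.\<close>

lemma guess_exists:
  assumes "petersen_input L"
  shows "\<exists>g\<in>set guesses. \<exists>k u w. suits g k u w"
proof -
  obtain n' k \<phi> where "3 \<le> n'" "1 \<le> k" "2 * k < n'" "gp_embedding (adj_of L) (length L) n' k \<phi>"
    using assms unfolding petersen_input_def by blast
  then obtain u0 w0 where lab0: "petersen_labelling (adj_of L) (length L) n' k u0 w0"
    using gp_embedding_imp_labelling bound by blast
  then have "n' = n" using length_L by (simp add: petersen_labelling_def)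
  then interpret l0: petersen_labelling "adj_of L" "length L" n k u0 w0 using lab0 by simp
  have pos: "0 < length L" using length_L n by simp
  obtain x where x: "0 = u0 x \<or> 0 = w0 x" using l0.covers[OF pos] by blast
  define u w where "u i = u0 (x + i)" and "w i = w0 (x + i)" for i
  have lab: "petersen_labelling (adj_of L) (length L) n k u w"
    unfolding u_def w_def by (rule l0.labelling_shifted)
  then interpret petersen_labelling "adj_of L" "length L" n k u w .
  have "0 = u 0 \<or> 0 = w 0" using x by (simp add: u_def w_def)
  then have start: "\<exists>s\<in>set starts. \<forall>R m. base R m \<longrightarrow> val s R m = u 0"
  proof
    assume "0 = u 0"
    then show ?thesis by (auto simp: starts_def)
  next
    assume "0 = w 0"
    then have "adj_of L 0 (u 0)" using adj_w[of 0 "u 0"] by simp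
    then obtain d where d: "d < 3" "L ! 0 ! d = u 0" using adj_iff[OF pos] by blast
    have "nbE (Lit 0) d \<in> set starts" using d(1) by (auto simp: starts_def less_Suc_eq numeral_3_eq_3 numeral_2_eq_2)
    moreover have "val (nbE (Lit 0) d) R m = u 0" if "base R m" for R m
      using that val_nbE_graph[of m "Lit 0" R d] d pos by (simp add: base_def)
    ultimately show ?thesis by blast
  qed
  then obtain s where s: "s \<in> set starts" "\<forall>R m. base R m \<longrightarrow> val s R m = u 0" by blast
  have nb: "\<exists>d\<in>set [0, 1, 2]. d < 3 \<and> L ! v ! d = z" if "adj_of L v z" "v < length L" for v z
    using that adj_iff[OF that(2)] by (auto simp: less_3)
  have "adj_of L (u 0) (w 0)" "adj_of L (u 0) (u 1)" "adj_of L (w 0) (w (int k))"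
    by (simp_all add: adj_u adj_w)
  note nb[OF this(1) less(1)] nb[OF this(2) less(1)] nb[OF this(3) less(2)]
  then obtain ib ic d where ib: "ib \<in> set [0, 1, 2]" "ib < 3" "L ! u 0 ! ib = w 0"
    and ic: "ic \<in> set [0, 1, 2]" "ic < 3" "L ! u 0 ! ic = u 1"
    and d: "d \<in> set [0, 1, 2]" "d < 3" "L ! w 0 ! d = w (int k)" by blast
  obtain T where T: "T \<in> set rules" "follows T n u w" using rule_exists[OF lab] by blast
  have "(s, ib, ic, T, d) \<in> set guesses"
    using s(1) ib(1) ic(1) d(1) T(1) by (simp add: guesses_def set_product del: List.product.simps)
  moreover have "suits (s, ib, ic, T, d) k u w"
    using lab s(2) ib ic d T(2) by (simp add: labelling_def)
  ultimately show ?thesis by blast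
qed

lemma ok_all_attempts:
  assumes "bounded_state M R m" "base R m" "R 0 = 0"
  shows "ok_here (foldr (\<lambda>g. Seq (attempt g)) guesses Skip) R m
    (\<lambda>R' m'. R' 0 = (if petersen_input L then 1 else 0))"
proof -
  have "R 0 = 0 \<or> R 0 = 1 \<and> petersen_input L" using assms(3) by simp
  from ok_attempts[OF assms(1,2) subset_refl this] show ?thesis
    by (rule ok_mono[OF _ assms(1)]) (use guess_exists in auto)
qed

end

section \<open>The encoded input\<close>

lemma length_encode: "length L + 1 \<le> length (encode L)"
  unfolding encode_def by (induction L) auto

text \<open>As long as the degrees are three, each vertex takes four cells.\<close>

lemma drop_encode:
  assumes "i < length L" "\<And>j. j < i \<Longrightarrow> length (L ! j) = 3"
  shows "\<exists>ys. drop (1 + 4 * i) (encode L) = length (L ! i) # L ! i @ ys"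
proof -
  let ?f = "\<lambda>l. length l # l"
  have len: "length (concat (map ?f (take j L))) = 4 * j" if "j \<le> i" for j
    using that assms by (induction j) (auto simp: take_Suc_conv_app_nth)
  have "encode L = (length L # concat (map ?f (take i L))) @ ?f (L ! i) @ concat (map ?f (drop (Suc i) L))"
    unfolding encode_def by (subst (2) id_take_nth_drop[OF assms(1)]) simp
  moreover have "length (length L # concat (map ?f (take i L))) = 1 + 4 * i" using len by simp
  ultimately have "drop (1 + 4 * i) (encode L) = ?f (L ! i) @ concat (map ?f (drop (Suc i) L))"
    by (simp only: drop_append) simp
  then show ?thesis by auto
qed

lemma mem_init_drop:
  assumes "drop i xs = ys @ zs" "j < length ys"
  shows "mem (init xs) (i + j) = ys ! j"
proof -
  have "i + j < length xs" using assms by (metis add.commute length_append length_drop less_diff_conv trans_less_add1)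
  then show ?thesis using assms by (simp add: init_def flip: nth_drop) (simp add: nth_append)
qed

lemma encode_degree:
  assumes "i < length L" "\<And>j. j < i \<Longrightarrow> length (L ! j) = 3"
  shows "mem (init (encode L)) (1 + 4 * i) = length (L ! i)"
  using drop_encode[OF assms] mem_init_drop[of "1 + 4 * i" "encode L" "[length (L ! i)]" _ 0] by auto

lemma encode_graph_mem:
  assumes "\<And>v. v < length L \<Longrightarrow> length (L ! v) = 3"
  shows "graph_mem L (mem (init (encode L)))"
  unfolding graph_mem_def
proof (intro allI impI)
  fix v d :: nat assume v: "v < length L" "d < 3"
  then obtain ys where "drop (1 + 4 * v) (encode L) = (length (L ! v) # L ! v) @ ys"
    using drop_encode[of v L] assms by auto
  from mem_init_drop[OF this, of "1 + d"] show "mem (init (encode L)) (2 + d + 4 * v) = L ! v ! d"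
    using assms v by (simp add: algebra_simps)
qed

text \<open>By induction along the encoding, as the place of each degree depends on the degrees before it.\<close>

lemma degrees_iff:
  "(\<forall>i<length L. mem (init (encode L)) (1 + 4 * i) = 3) \<longleftrightarrow> (\<forall>i<length L. length (L ! i) = 3)"
proof
  assume *: "\<forall>i<length L. mem (init (encode L)) (1 + 4 * i) = 3"
  have "i < length L \<longrightarrow> length (L ! i) = 3" for i
  proof (induction i rule: less_induct)
    case (less i)
    then show ?case using encode_degree[of i L] * by auto
  qed
  then show "\<forall>i<length L. length (L ! i) = 3" by blast
next
  assume "\<forall>i<length L. length (L ! i) = 3"
  then show "\<forall>i<length L. mem (init (encode L)) (1 + 4 * i) = 3"
    using encode_degree[of _ L] less_trans by metis
qed

lemma encode_le:
  assumes "adjacency_lists V E L" "x \<in> set (encode L)"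
  shows "x \<le> length L"
proof -
  have *: "length l \<le> length L \<and> set l \<subseteq> {..<length L}" if l: "l \<in> set L" for l
  proof -
    have "distinct l \<and> set l \<subseteq> {..<length L}"
      using assms(1) l unfolding adjacency_lists_def by (auto simp: in_set_conv_nth)
    then show ?thesis using card_mono[of "{..<length L}" "set l"] by (auto simp: distinct_card)
  qed
  have "x = length L \<or> (\<exists>l\<in>set L. x = length l \<or> x \<in> set l)"
    using assms(2) by (auto simp: encode_def)
  then show ?thesis using * by fastforce
qed

lemma adjacency_lists_graph:
  assumes "adjacency_lists V E L"
  shows "is_generalized_Petersen V E \<longleftrightarrow> petersen_input L"
    and "adj_of L v z \<Longrightarrow> z < length L" and "adj_of L v z \<Longrightarrow> adj_of L z v"
    and "v < length L \<Longrightarrow> card {z. adj_of L v z} = length (L ! v)"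
proof -
  show "is_generalized_Petersen V E \<longleftrightarrow> petersen_input L"
    using is_generalized_Petersen_iff[OF assms] unfolding petersen_input_def adj_of_def[abs_def] .
  obtain vs where vs: "\<And>i. i < length L \<Longrightarrow> distinct (L ! i) \<and>
      set (L ! i) = {j. j < length L \<and> {vs ! i, vs ! j} \<in> E}"
    using assms unfolding adjacency_lists_def by blast
  show "adj_of L v z \<Longrightarrow> z < length L" "adj_of L v z \<Longrightarrow> adj_of L z v"
    using vs by (auto simp: adj_of_def insert_commute)
  show "v < length L \<Longrightarrow> card {z. adj_of L v z} = length (L ! v)"
    using vs[of v] distinct_card[of "L ! v"] by (simp add: adj_of_def del: mem_Collect_eq) 
qed

lemma petersen_input_cubic:
  assumes "adjacency_lists V E L" "petersen_input L"
  shows "length L = 2 * (length L div 2)" "3 \<le> length L div 2"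
    and "\<And>v. v < length L \<Longrightarrow> length (L ! v) = 3"
proof -
  obtain n k \<phi> where "3 \<le> n" "1 \<le> k" "2 * k < n" "gp_embedding (adj_of L) (length L) n k \<phi>"
    using assms(2) unfolding petersen_input_def by blast
  then obtain u w where "petersen_labelling (adj_of L) (length L) n k u w"
    using gp_embedding_imp_labelling adjacency_lists_graph(2)[OF assms(1)] by blast
  then interpret petersen_labelling "adj_of L" "length L" n k u w .
  show "length L = 2 * (length L div 2)" "3 \<le> length L div 2" using N n by auto
  show "length (L ! v) = 3" if "v < length L" for v
    using degree[OF that] adjacency_lists_graph(4)[OF assms(1) that] by simp
qed

section \<open>Recognition in linear time\<close>

lemma ok_recognizer:
  assumes adj: "adjacency_lists V E L"
  shows "ok (length L + 2) (length L) recognizer (\<lambda>_. 0) (mem (init (encode L)))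
    (\<lambda>R m. R 0 = (if is_generalized_Petersen V E then 1 else 0))"
proof -
  let ?N = "length L"
  let ?M = "?N + 2"
  define n where "n = ?N div 2"
  define m0 where "m0 = mem (init (encode L))"
  have m0: "m0 a \<le> ?N" for a
    using encode_le[OF adj, of "encode L ! a"] by (auto simp: m0_def init_def)
  have b: "bounded_state ?M (\<lambda>_. 0) m0"
    unfolding bounded_state_def using m0 by (simp add: le_SucI)
  have m00: "m0 0 = ?N" using length_encode[of L] by (auto simp: m0_def init_def encode_def)
  define flag where "flag = (if ?N = 2 * n \<and> 2 < n then 1 else 0 :: nat)"
  define R0 where "R0 = (\<lambda>_::nat. 0 :: nat)(10 := ?N, 2 := n, 9 := flag, 3 := 0)"
  have 1: "ok ?M ?N (Seq (Assign 10 (Cell (Lit 0))) (Seq (Assign 2 (Bin Div (Var 10) (Lit 2)))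
      (Seq (Cond (andE (eqE (Var 10) (Bin Mul (Lit 2) (Var 2))) (lessE (Lit 2) (Var 2)))
             (Assign 9 (Lit 1)) (Assign 9 (Lit 0)))
        (Assign 3 (Lit 0))))) (\<lambda>_. 0) m0 (\<lambda>R' m'. R' = R0 \<and> m' = m0)"
    by (rule wp_ok[OF b]) (simp add: m00 R0_def flag_def n_def le_SucI)
  define I where "I j R m \<longleftrightarrow> m = m0 \<and> R 10 = ?N \<and> R 2 = n \<and> R 0 = 0 \<and> R 3 = j \<and>
    (R 9 \<noteq> 0 \<longleftrightarrow> (?N = 2 * n \<and> 3 \<le> n) \<and> (\<forall>i<j. m0 (1 + 4 * i) = 3))" for j m and R :: "nat \<Rightarrow> nat"
  have 2: "ok ?M ?N (While (lessE (Var 3) (Var 10))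
      (Seq (Cond (eqE (Cell (Bin Add (Lit 1) (Bin Mul (Lit 4) (Var 3)))) (Lit 3))
        Skip (Assign 9 (Lit 0))) increment)) R0 m0 (I ?N)" if b0: "bounded_state ?M R0 m0"
  proof (rule ok_While[OF b0])
    show "I 0 R0 m0" by (auto simp: I_def R0_def flag_def)
    show "\<not> holds R m (lessE (Var 3) (Var 10))" if "I ?N R m" for R m
      using that by (simp add: I_def)
    fix j R m assume j: "j < ?N" and I: "I j R m" and b': "bounded_state ?M R m"
    have "ok ?M ?N (Seq (Cond (eqE (Cell (Bin Add (Lit 1) (Bin Mul (Lit 4) (Var 3)))) (Lit 3))
        Skip (Assign 9 (Lit 0))) increment) R m (I (Suc j))"
      using I j
      by (intro wp_ok[OF b'], cases "m0 (1 + 4 * j) = 3")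
        (simp_all add: increment_def I_def All_less_Suc)
    then show "holds R m (lessE (Var 3) (Var 10)) \<and>
      ok ?M ?N (Seq (Cond (eqE (Cell (Bin Add (Lit 1) (Bin Mul (Lit 4) (Var 3)))) (Lit 3))
        Skip (Assign 9 (Lit 0))) increment) R m (I (Suc j))"
      using I j by (simp add: I_def)
  qed simp
  have 3: "ok ?M ?N (Cond (Var 9) (foldr (\<lambda>g. Seq (attempt g)) guesses Skip) Skip) R m
    (\<lambda>R m. R 0 = (if is_generalized_Petersen V E then 1 else 0))"
    if I: "I ?N R m" and b': "bounded_state ?M R m" for R m
  proof (rule ok_Cond)
    assume "holds R m (Var 9)"
    then have N: "?N = 2 * n" "3 \<le> n" and "\<forall>i<?N. m0 (1 + 4 * i) = 3" using I by (auto simp: I_def)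
    then have deg: "\<forall>i<?N. length (L ! i) = 3" using degrees_iff[of L] by (simp add: m0_def)
    interpret even_cubic_input L n
      using adjacency_lists_graph(2,3)[OF adj] deg N by unfold_locales auto
    have "base R m" using I encode_graph_mem[of L] deg by (simp add: base_def I_def m0_def)
    moreover have "R 0 = 0" using I by (simp add: I_def)
    ultimately show "ok ?M ?N (foldr (\<lambda>g. Seq (attempt g)) guesses Skip) R m
      (\<lambda>R m. R 0 = (if is_generalized_Petersen V E then 1 else 0))"
      using ok_all_attempts[OF b'] adjacency_lists_graph(1)[OF adj] by simp
  next
    assume "\<not> holds R m (Var 9)"
    then have "\<not> ((?N = 2 * n \<and> 3 \<le> n) \<and> (\<forall>i<?N. m0 (1 + 4 * i) = 3))"
      using I unfolding I_def holds_Var by blast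
    then have "\<not> ((?N = 2 * n \<and> 3 \<le> n) \<and> (\<forall>i<?N. length (L ! i) = 3))"
      unfolding m0_def degrees_iff .
    then have "\<not> petersen_input L"
      using petersen_input_cubic[OF adj] unfolding n_def by blast
    then show "ok ?M ?N Skip R m (\<lambda>R m. R 0 = (if is_generalized_Petersen V E then 1 else 0))"
      using I adjacency_lists_graph(1)[OF adj] by (intro ok_Skip) (simp add: I_def)
  qed
  show ?thesis
    unfolding recognizer_def m0_def[symmetric]
  proof (rule ok_Seq[OF 1 b], elim conjE, hypsubst)
    assume b0: "bounded_state ?M R0 m0"
    show "ok ?M ?N (Seq (While (lessE (Var 3) (Var 10))
        (Seq (Cond (eqE (Cell (Bin Add (Lit 1) (Bin Mul (Lit 4) (Var 3)))) (Lit 3))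
          Skip (Assign 9 (Lit 0))) increment))
        (Cond (Var 9) (foldr (\<lambda>g. Seq (attempt g)) guesses Skip) Skip)) R0 m0
      (\<lambda>R m. R 0 = (if is_generalized_Petersen V E then 1 else 0))"
      by (rule ok_Seq[OF 2[OF b0] b0 3])
  qed
qed

lemma decides_within_mono:
  "decides_within P c xs T ans \<Longrightarrow> T \<le> T' \<Longrightarrow> decides_within P c xs T' ans"
  unfolding decides_within_def by (meson le_trans)

text \<open>Every loop is bounded by the number of vertices, so the running time is at most a constant times \<open>|V| + 1\<close>. Both
claims follow, the second one from \<open>2 n + 1 \<le> 3 n\<close>.\<close>

theorem mainTheorem1:
  "\<exists>P c.
     recognizes_gp_in_linear_time P c \<and>
     (\<exists>C. \<forall>n\<ge>1. \<forall>(V :: nat set) E L.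
        simple_graph V E \<and> adjacency_lists V E L \<and> cubic V E \<and> card V = 2 * n \<longrightarrow>
          decides_within P c (encode L) (C * n) (is_generalized_Petersen V E))"
proof -
  define K where "K = csize recognizer"
  define P where "P = compile K 0 recognizer"
  have *: "decides_within P (K + 1) (encode L) (K * (card V + 1)) (is_generalized_Petersen V E)"
    if "adjacency_lists V E L" for V :: "nat set" and E L
  proof -
    have "card V = length L" using that unfolding adjacency_lists_def by (metis distinct_card)
    moreover have "x \<le> length L + 2" if "x \<in> set (encode L)" for x
      using encode_le[OF \<open>adjacency_lists V E L\<close> that] by simp
    ultimately show ?thesis
      unfolding P_def K_def
      using compiled_program_decides[OF unnested_recognizer ok_recognizer[OF that] length_encode] by simp
  qed
  have "recognizes_gp_in_linear_time P (K + 1)"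
    unfolding recognizes_gp_in_linear_time_def
  proof (intro exI[of _ K] allI impI; elim conjE)
    fix V :: "nat set" and E L assume "adjacency_lists V E L"
    from *[OF this]
    show "decides_within P (K + 1) (encode L) (K * (card V + card E + 1)) (is_generalized_Petersen V E)"
      by (rule decides_within_mono) simp
  qed
  moreover have "decides_within P (K + 1) (encode L) (3 * K * n) (is_generalized_Petersen V E)"
    if "1 \<le> n" "adjacency_lists V E L" "card V = 2 * n" for n and V :: "nat set" and E L
  proof -
    have "K * (card V + 1) \<le> K * (3 * n)" using that(1,3) by (intro mult_le_mono2) simp
    then show ?thesis using *[OF that(2)] by (intro decides_within_mono[OF *[OF that(2)]]) (simp add: mult_ac)
  qed
  ultimately show ?thesis by blast
qed

end
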